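(* Let $p=p(n)\in[0,1]$ be such that $pn-\log n\to\infty$ as $n\to\infty$, and let $G\in G(n,p)$. Then there is a constant $C>0$ such that, with probability tending to $1$ as $n\to\infty$, $G$ is connected and $$\mathcal{AC}(G)\le C\,\frac{\log n}{p}.$$
   Context: $G(n,p)$ is the binomial random graph on vertex set $[n]=\{1,\dots,n\}$ in which each pair of vertices is an edge independently with probability $p$. For a finite connected graph $G=(V,E)$, the acquaintance time $\mathcal{AC}(G)$ is defined as follows. Initially one agent is placed on each vertex. Two agents are acquainted (and remain so forever) once, at some time (including the start), they occupy the two endpoints of an edge. In each round one chooses a matching $M$ of $G$ (any matching, possibly a single edge) and, for every edge of $M$, swaps the agents on its endpoints. $\mathcal{AC}(G)$ is the minimum number of rounds needed until every pair of agents is acquainted. $\log$ denotes the natural logarithm. *)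

theory Defs
  imports "HOL-Probability.Probability" "HOL-Library.Ramsey"
begin

text \<open>A graph is given by a vertex set \<open>V\<close> and an edge set \<open>E \<subseteq> [V]\<^bsup>2\<^esup>\<close> of unordered
  pairs; it is sampled by its edge set.\<close>

definition gnp :: "nat \<Rightarrow> real \<Rightarrow> nat set set pmf" where
  "gnp n p =
     map_pmf (\<lambda>\<omega>. {e \<in> [{1..n}]\<^bsup>2\<^esup>. \<omega> e})
       (Pi_pmf ([{1..n}]\<^bsup>2\<^esup>) False (\<lambda>_. bernoulli_pmf p))"

definition connected_graph :: "'a set \<Rightarrow> 'a set set \<Rightarrow> bool" where
  "connected_graph V E \<longleftrightarrow>
     V \<noteq> {} \<and> (\<forall>u\<in>V. \<forall>v\<in>V. (u, v) \<in> {(x, y). {x, y} \<in> E}\<^sup>*)"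

definition graph_matching :: "'a set set \<Rightarrow> 'a set set \<Rightarrow> bool" where
  "graph_matching E M \<longleftrightarrow> M \<subseteq> E \<and> pairwise disjnt M"

definition swap_along :: "'a set set \<Rightarrow> 'a \<Rightarrow> 'a" where
  "swap_along M v = (if v \<in> \<Union>M then THE w. {v, w} \<in> M else v)"

text \<open>An agent is identified with its initial vertex, and a strategy with the list of the
  matchings used in successive rounds.\<close>

definition agent_position :: "'a set set list \<Rightarrow> nat \<Rightarrow> 'a \<Rightarrow> 'a" where
  "agent_position Ms t a = fold swap_along (take t Ms) a"

definition acquainted :: "'a set set \<Rightarrow> 'a set set list \<Rightarrow> 'a \<Rightarrow> 'a \<Rightarrow> bool" where
  "acquainted E Ms a b \<longleftrightarrow>
     (\<exists>t\<le>length Ms. {agent_position Ms t a, agent_position Ms t b} \<in> E)"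

definition acquaintance_strategy :: "'a set \<Rightarrow> 'a set set \<Rightarrow> 'a set set list \<Rightarrow> bool" where
  "acquaintance_strategy V E Ms \<longleftrightarrow>
     (\<forall>M\<in>set Ms. graph_matching E M) \<and>
     (\<forall>a\<in>V. \<forall>b\<in>V. a \<noteq> b \<longrightarrow> acquainted E Ms a b)"

text \<open>The value is \<open>\<infinity>\<close> if no strategy exists. The empty matching is allowed as a round;
  deleting such rounds from a strategy leaves a strategy, so the minimum is not affected.\<close>

definition acquaintance_time :: "'a set \<Rightarrow> 'a set set \<Rightarrow> enat" where
  "acquaintance_time V E = (INF Ms \<in> {Ms. acquaintance_strategy V E Ms}. enat (length Ms))"

end

theory Submission imports Defs begin

text \<open>Let \<open>H\<close> be a connected graph on \<open>b\<close> vertices that contains a path \<open>P\<close> on at least a constant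
  fraction of them. Any sufficiently small set of agents can be brought onto \<open>P\<close> in \<open>O(b)\<close> rounds:
  root a spanning tree at an end of \<open>P\<close> and let the chosen agents climb towards the root in a
  pipeline. An odd-even rotation of \<open>P\<close> then acquaints all agents on it and takes each of them
  through every vertex of \<open>P\<close>. Doing this for boundedly many sets of agents that cover all pairs
  gives a strategy of length \<open>O(b)\<close> in which every agent visits \<open>\<Omega>(b)\<close> vertices.

  Split \<open>[n]\<close> into blocks of size of order \<open>k = min n (K log n / p)\<close>. With high probability every
  block induces a connected graph in which any two disjoint sets of a quarter of the vertices are
  joined by an edge, and depth-first search finds a long path in such a graph. Running the
  strategies of all blocks in parallel, two agents from different blocks occupy \<open>\<Omega>(k)\<close> distinct pairs
  of vertices. The trajectories depend only on the edges inside the blocks, so these pairs are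
  independent of them and all are non-edges with probability \<open>(1 - p)\<^bsup>\<Omega>(k)\<^esup>\<close>, which beats a union
  bound over all pairs of agents. Connectedness of the whole graph follows from the existence of
  the strategy.\<close>

section \<open>Trajectories and pipelined routing\<close>

lemma swap_along_notin: "v \<notin> \<Union>M \<Longrightarrow> swap_along M v = v"
  by (simp add: swap_along_def)

lemma swap_along_eq:
  assumes "pairwise disjnt M" "{v, w} \<in> M"
  shows "swap_along M v = w"
proof -
  have "(THE w. {v, w} \<in> M) = w"
  proof (rule the_equality)
    fix y assume "{v, y} \<in> M"
    then have "{v, y} = {v, w}"
      using pairwiseD[OF assms(1) _ assms(2), of "{v, y}"] by (auto simp: disjnt_def)
    then show "y = w" by (auto simp: doubleton_eq_iff)
  qed (use assms in auto)
  moreover have "v \<in> \<Union>M" using assms(2) by blast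
  ultimately show ?thesis by (simp add: swap_along_def)
qed

lemma nsets2D: "e \<in> [V]\<^bsup>2\<^esup> \<Longrightarrow> \<exists>x y. e = {x, y} \<and> x \<noteq> y \<and> x \<in> V \<and> y \<in> V"
  by (auto simp: nsets_def card_2_iff)

lemma pair_in_nsets2: "{x, y} \<in> [V]\<^bsup>2\<^esup> \<longleftrightarrow> x \<noteq> y \<and> x \<in> V \<and> y \<in> V"
  by (auto simp: nsets_def card_2_iff doubleton_eq_iff)

lemma swap_along_cases:
  assumes "graph_matching E M" "E \<subseteq> [V]\<^bsup>2\<^esup>"
  obtains "swap_along M v = v" "v \<notin> \<Union>M" | "{v, swap_along M v} \<in> M"
proof (cases "v \<in> \<Union>M")
  case True
  then obtain e where e: "e \<in> M" "v \<in> e" by auto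
  then have "e \<in> [V]\<^bsup>2\<^esup>" using assms by (auto simp: graph_matching_def)
  then obtain w where w: "e = {v, w}" using e nsets2D by (metis doubleton_eq_iff insertE singletonD)
  have "swap_along M v = w"
    by (rule swap_along_eq) (use assms w e in \<open>auto simp: graph_matching_def\<close>)
  then show ?thesis using that(2) w e by simp
next
  case False
  then show ?thesis using that(1) swap_along_notin by metis
qed

lemma swap_along_involution:
  assumes "graph_matching E M" "E \<subseteq> [V]\<^bsup>2\<^esup>"
  shows "swap_along M (swap_along M v) = v"
proof (rule swap_along_cases[OF assms, of v])
  assume "{v, swap_along M v} \<in> M"
  then have "{swap_along M v, v} \<in> M" by (subst insert_commute)
  then show ?thesis using assms(1) unfolding graph_matching_def by (intro swap_along_eq) blast+
next
  assume "swap_along M v = v"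
  then show ?thesis by metis
qed

lemma swap_along_in:
  assumes "graph_matching E M" "E \<subseteq> [V]\<^bsup>2\<^esup>" "v \<in> V"
  shows "swap_along M v \<in> V"
proof (rule swap_along_cases[OF assms(1,2), of v])
  assume "{v, swap_along M v} \<in> M"
  then have "{v, swap_along M v} \<in> [V]\<^bsup>2\<^esup>" using assms unfolding graph_matching_def by blast
  then show ?thesis by (simp add: pair_in_nsets2)
qed (use assms in simp)

lemma fold_swap_along_in:
  assumes "\<forall>M\<in>set Ms. graph_matching E M" "E \<subseteq> [V]\<^bsup>2\<^esup>" "v \<in> V"
  shows "fold swap_along Ms v \<in> V"
  using assms(1,3) by (induction Ms arbitrary: v) (auto intro: swap_along_in[OF _ assms(2)])

lemma inj_fold_swap_along:
  assumes "\<forall>M\<in>set Ms. graph_matching E M" "E \<subseteq> [V]\<^bsup>2\<^esup>"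
  shows "inj (fold swap_along Ms)"
  using assms(1)
proof (induction Ms)
  case (Cons M Ms)
  have "inj (swap_along M)"
    by (rule inj_on_inverseI[where g = "swap_along M"])
      (use Cons.prems assms(2) swap_along_involution in auto)
  from inj_compose[OF Cons.IH this] show ?case using Cons.prems by (simp add: comp_def)
qed (simp add: inj_on_def)

lemma agent_position_in:
  assumes "\<forall>M\<in>set Ms. graph_matching E M" "E \<subseteq> [V]\<^bsup>2\<^esup>" "v \<in> V"
  shows "agent_position Ms t v \<in> V"
  unfolding agent_position_def
  by (rule fold_swap_along_in) (use assms set_take_subset in fastforce)+

lemma agent_position_Suc:
  "t < length Ms \<Longrightarrow> agent_position Ms (Suc t) a = swap_along (Ms ! t) (agent_position Ms t a)"
  by (simp add: agent_position_def take_Suc_conv_app_nth)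

lemma agent_position_append:
  "agent_position (Ms @ Ns) (length Ms + t) a = agent_position Ns t (fold swap_along Ms a)"
  by (simp add: agent_position_def)

lemma agent_position_append_left:
  "t \<le> length Ms \<Longrightarrow> agent_position (Ms @ Ns) t a = agent_position Ms t a"
  by (simp add: agent_position_def)

text \<open>Token \<open>i\<close> waits until time \<open>2 i + D - dep (u i)\<close> and then climbs one level per round, so
  that climbing tokens are always at least two levels apart.\<close>

lemma pipelined_ascent:
  fixes E :: "'a set set" and u :: "nat \<Rightarrow> 'a" and dep :: "'a \<Rightarrow> nat" and D N :: nat
  assumes up: "\<And>v. v \<in> V \<Longrightarrow> dep v > 0 \<Longrightarrow>
      up v \<in> V \<and> {v, up v} \<in> E \<and> Suc (dep (up v)) = dep v"
    and depD: "\<And>v. v \<in> V \<Longrightarrow> dep v \<le> D"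
    and uV: "\<And>i. i < N \<Longrightarrow> u i \<in> V"
    and inj: "inj_on u {..<N}"
    and srt: "\<And>i j. i < j \<Longrightarrow> j < N \<Longrightarrow> dep (u i) \<le> dep (u j)"
    and room: "\<And>i. i < N \<Longrightarrow> i \<le> dep (u i)"
  obtains Ms where "length Ms = 2 * N + D" "\<forall>M\<in>set Ms. graph_matching E M"
    "\<And>i. i < N \<Longrightarrow> fold swap_along Ms (u i) = (up ^^ (dep (u i) - i)) (u i)"
    "\<And>v. (\<And>i k. i < N \<Longrightarrow> k \<le> dep (u i) - i \<Longrightarrow> v \<noteq> (up ^^ k) (u i)) \<Longrightarrow>
       fold swap_along Ms v = v"
proof -
  \<comment> \<open>The ancestor of \<open>u i\<close> at level \<open>x\<close>; with it a climb is
    described by levels alone.\<close>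
  define q where "q = (\<lambda>i x. (up ^^ (dep (u i) - x)) (u i))"
  have itV: "(up ^^ k) v \<in> V \<and> dep ((up ^^ k) v) = dep v - k" if "v \<in> V" "k \<le> dep v" for v k
    using that(2)
  proof (induction k)
    case (Suc k)
    then show ?case using up[of "(up ^^ k) v"] by auto
  qed (use that in simp)
  have qV: "q i x \<in> V" "dep (q i x) = x" if "i < N" "x \<le> dep (u i)" for i x
    using itV[OF uV[OF that(1)], of "dep (u i) - x"] that by (auto simp: q_def)
  have qnxt: "up (q i x) = q i (x - 1)" if "0 < x" "x \<le> dep (u i)" for i x
  proof -
    have "dep (u i) - (x - 1) = Suc (dep (u i) - x)" using that by simp
    then show ?thesis by (simp add: q_def)
  qed
  have qE: "{q i x, q i (x - 1)} \<in> E" if "i < N" "0 < x" "x \<le> dep (u i)" for i x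
    using up[OF qV(1)[OF that(1,3)]] qV(2)[OF that(1,3)] qnxt[OF that(2,3)] that by simp
  \<comment> \<open>\<open>c i - t\<close> is a countdown. Token \<open>i\<close> waits while the
    countdown exceeds \<open>dep (u i)\<close>, then its level \<open>X i t\<close> equals the
    countdown until it stops at level \<open>i\<close>. Consecutive countdowns differ by
    \<open>2\<close>.\<close>
  define c where "c = (\<lambda>i::nat. 2 * i + D)"
  define X where "X = (\<lambda>i t::nat. max i (min (dep (u i)) (c i - t)))"
  have X: "i \<le> X i t" "X i t \<le> dep (u i)" if "i < N" for i t
    using room[OF that] unfolding X_def by simp_all
  define mov where "mov i t \<longleftrightarrow> i < N \<and> i < c i - t \<and> c i - t \<le> dep (u i)" for i t
  have Xmov: "X i t = c i - t" "X i (Suc t) = X i t - 1" if "mov i t" for i t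
    using that unfolding X_def mov_def by linarith+
  have Xnot: "X i (Suc t) = X i t" if "i < N" "\<not> mov i t" for i t
    using that room[OF that(1)] unfolding X_def mov_def by linarith
  define M where "M t = (\<lambda>i. {q i (X i t), q i (X i t - 1)}) ` {i. mov i t}" for t
  have gap: "X j t \<ge> X i t + 2" if "mov i t" "mov j t" "i < j" for i j t
    using that Xmov(1)[OF that(1)] Xmov(1)[OF that(2)] unfolding mov_def c_def by linarith
  have movN: "i < N" if "mov i t" for i t using that by (simp add: mov_def)
  have mov0: "X i t > 0" if "mov i t" for i t using that by (auto simp: Xmov mov_def)
  \<comment> \<open>An edge used by token \<open>i\<close> touches only the levels
    \<open>X i t\<close> and \<open>X i t - 1\<close>. Moving tokens are two levels apart, so their
    edges are disjoint.\<close>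
  have depM: "dep v = X i t \<or> Suc (dep v) = X i t"
    if "v \<in> {q i (X i t), q i (X i t - 1)}" "mov i t" for i t v
  proof -
    note iN = movN[OF that(2)]
    have "X i t - 1 \<le> dep (u i)" using X(2)[OF iN, of t] by simp
    then have "dep (q i (X i t - 1)) = X i t - 1" "dep (q i (X i t)) = X i t"
      using qV(2)[OF iN] X(2)[OF iN, of t] by blast+
    moreover have "v = q i (X i t) \<or> v = q i (X i t - 1)" using that(1) by blast
    ultimately show ?thesis using mov0[OF that(2)] by (elim disjE) simp_all
  qed
  have gm: "graph_matching E (M t)" for t
    unfolding graph_matching_def
  proof
    show "M t \<subseteq> E" using qE movN mov0 X(2) by (auto simp: M_def)
    show "pairwise disjnt (M t)"
      unfolding pairwise_def
    proof (intro ballI impI)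
      fix e f assume "e \<in> M t" "f \<in> M t" "e \<noteq> f"
      then obtain i j where ij: "mov i t" "mov j t" "e = {q i (X i t), q i (X i t - 1)}"
        "f = {q j (X j t), q j (X j t - 1)}" by (auto simp: M_def)
      with \<open>e \<noteq> f\<close> have "i < j \<or> j < i" by (metis nat_neq_iff)
      then have gp: "X j t \<ge> X i t + 2 \<or> X i t \<ge> X j t + 2" using gap ij by blast
      show "disjnt e f"
        unfolding disjnt_iff
      proof (intro allI notI)
        fix x assume x: "x \<in> e \<and> x \<in> f"
        then have "dep x = X i t \<or> Suc (dep x) = X i t" "dep x = X j t \<or> Suc (dep x) = X j t"
          using depM ij by blast+
        then show False using gp by linarith
      qed
    qed
  qed
  have pos: "fold swap_along (map M [0..<t]) (u i) = q i (X i t)" if "i < N" for i t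
  proof (induction t)
    case 0
    have "X i 0 = dep (u i)" using depD[OF uV[OF that]] room[OF that] by (auto simp: X_def c_def)
    then show ?case by (simp add: q_def)
  next
    case (Suc t)
    have "swap_along (M t) (q i (X i t)) = q i (X i (Suc t))"
    proof (cases "mov i t")
      case True
      then have "{q i (X i t), q i (X i t - 1)} \<in> M t" by (auto simp: M_def)
      then show ?thesis using gm[of t] Xmov[OF True] by (intro swap_along_eq) (auto simp: graph_matching_def)
    next
      case False
      \<comment> \<open>A resting token is not hit by a moving token \<open>j\<close>. If
        \<open>j < i\<close> and token \<open>i\<close> still waits, the sorting forces
        \<open>j\<close> to be at its own start on the same vertex, against injectivity; if token
        \<open>i\<close> has stopped, \<open>j\<close> is already below it. If \<open>i < j\<close>,
        the larger countdown or the stopping level \<open>j\<close> keeps both ends of the edge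
        above token \<open>i\<close>.\<close>
      have "q i (X i t) \<notin> \<Union>(M t)"
      proof
        assume "q i (X i t) \<in> \<Union>(M t)"
        then obtain j where j: "mov j t" "q i (X i t) \<in> {q j (X j t), q j (X j t - 1)}"
          by (auto simp: M_def)
        have ne: "i \<noteq> j" using j False by auto
        have dd: "X i t = X j t \<or> Suc (X i t) = X j t"
          using depM[OF j(2,1)] qV(2)[OF that X(2)[OF that]] by simp
        have Xj: "X j t = c j - t" using Xmov(1)[OF j(1)] .
        have jN: "j < N" using movN j by blast
        have cs: "(c i - t > dep (u i) \<and> X i t = dep (u i)) \<or> (c i - t \<le> i \<and> X i t = i)"
          using False that room[OF that] by (auto simp: mov_def X_def)
        show False
        proof (cases "j < i")
          case True
          have "X j t < c i - t" "j < c j - t" using j True Xj by (auto simp: c_def mov_def)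
          show ?thesis using cs
          proof
            assume *: "c i - t > dep (u i) \<and> X i t = dep (u i)"
            have "dep (u j) \<le> dep (u i)" using srt True that by blast
            with * dd have "X i t = X j t" "dep (u j) = dep (u i)" "X j t = dep (u j)"
              using X(2)[OF jN, of t] by auto
            then have "q i (X i t) = u i" "q j (X j t) = u j" using * by (auto simp: q_def)
            moreover have "q i (X i t) = q j (X j t)"
            proof (rule ccontr)
              assume "q i (X i t) \<noteq> q j (X j t)"
              then have "q i (X i t) = q j (X j t - 1)" using j by auto
              then have "X i t = X j t - 1"
                using qV(2)[OF that X(2)[OF that], of t] qV(2)[OF jN, of "X j t - 1"] X(2)[OF jN, of t] by simp
              then show False using \<open>X i t = X j t\<close> mov0[OF j(1)] by simp
            qed
            ultimately have "u i = u j" by simp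
            then show False using inj ne that jN by (auto simp: inj_on_def)
          next
            assume *: "c i - t \<le> i \<and> X i t = i"
            then show False using dd Xj j True by (auto simp: c_def mov_def)
          qed
        next
          case False
          then have "i < j" using ne by simp
          show ?thesis using cs
          proof
            assume *: "c i - t > dep (u i) \<and> X i t = dep (u i)"
            then show False using dd Xj \<open>i < j\<close> by (auto simp: c_def)
          next
            assume *: "c i - t \<le> i \<and> X i t = i"
            then show False using dd Xj \<open>i < j\<close> X(1)[OF jN, of t] j
              by (auto simp: mov_def)
          qed
        qed
      qed
      then show ?thesis using Xnot[OF that False] swap_along_notin by metis
    qed
    then show ?case using Suc by simp
  qed
  have fixd: "fold swap_along (map M [0..<t]) v = v"
    if "\<And>i k. i < N \<Longrightarrow> k \<le> dep (u i) - i \<Longrightarrow> v \<noteq> (up ^^ k) (u i)" for t v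
  proof (induction t)
    case (Suc t)
    have "v \<notin> \<Union>(M t)"
    proof
      assume "v \<in> \<Union>(M t)"
      then obtain j where j: "mov j t" "v \<in> {q j (X j t), q j (X j t - 1)}"
        by (auto simp: M_def)
      then have "v = q j (X j t) \<or> v = q j (X j t - 1)" by auto
      moreover have "X j t > j" using j Xmov(1) by (auto simp: mov_def)
      moreover have "dep (u j) - X j t \<le> dep (u j) - j" "dep (u j) - (X j t - 1) \<le> dep (u j) - j"
        using \<open>X j t > j\<close> by simp_all
      ultimately show False using that[OF movN[OF j(1)], of "dep (u j) - X j t"]
          that[OF movN[OF j(1)], of "dep (u j) - (X j t - 1)"] by (auto simp: q_def)
    qed
    then have "swap_along (M t) v = v" by (rule swap_along_notin)
    then show ?case using Suc.IH by simp
  qed simp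
  have fin: "X i (2 * N + D) = i" if "i < N" for i
    using that room[OF that] by (auto simp: X_def c_def)
  show thesis
  proof (rule that[of "map M [0..<2 * N + D]"])
    show "\<forall>M\<in>set (map M [0..<2 * N + D]). graph_matching E M" using gm by auto
    show "fold swap_along (map M [0..<2 * N + D]) (u i) = (up ^^ (dep (u i) - i)) (u i)"
      if "i < N" for i
      using pos[OF that, of "2 * N + D"] fin[OF that] by (simp add: q_def)
    show "fold swap_along (map M [0..<2 * N + D]) v = v"
      if "\<And>i k. i < N \<Longrightarrow> k \<le> dep (u i) - i \<Longrightarrow> v \<noteq> (up ^^ k) (u i)" for v
      using fixd[OF that] by blast
  qed simp
qed

section \<open>Gathering agents on a path\<close>

text \<open>Take for \<open>dst\<close> the length of a shortest walk to \<open>P\<close>; the first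
  step of such a walk lowers it by exactly one and supplies \<open>par\<close>.\<close>

lemma forest_to_set:
  fixes E :: "'a set set"
  assumes "connected_graph V E" "E \<subseteq> [V]\<^bsup>2\<^esup>" "P \<subseteq> V" "P \<noteq> {}"
  shows "\<exists>(par :: 'a \<Rightarrow> 'a) (dst :: 'a \<Rightarrow> nat). \<forall>v\<in>V. (dst v = 0 \<longleftrightarrow> v \<in> P) \<and>
    (dst v > 0 \<longrightarrow> par v \<in> V \<and> {v, par v} \<in> E \<and> Suc (dst (par v)) = dst v)"
proof -
  define R where "R = {(x, y). {x, y} \<in> E}"
  define dst where "dst = (\<lambda>v. LEAST k. \<exists>w\<in>P. (v, w) \<in> R ^^ k)"
  obtain w0 where w0: "w0 \<in> P" using assms by blast
  have ex: "\<exists>k. \<exists>w\<in>P. (v, w) \<in> R ^^ k" if "v \<in> V" for v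
  proof -
    have "(v, w0) \<in> R\<^sup>*" using assms w0 that by (auto simp: connected_graph_def R_def)
    then show ?thesis using w0 rtrancl_imp_relpow by blast
  qed
  have walk: "\<exists>w\<in>P. (v, w) \<in> R ^^ dst v" if "v \<in> V" for v
    unfolding dst_def using LeastI_ex[OF ex[OF that]] .
  have least: "dst v \<le> k" if "w \<in> P" "(v, w) \<in> R ^^ k" for v w k
    unfolding dst_def by (rule Least_le) (use that in blast)
  have zero: "dst v = 0 \<longleftrightarrow> v \<in> P" if "v \<in> V" for v
    using walk[OF that] least[of v v 0] by auto
  have step: "\<exists>w. w \<in> V \<and> {v, w} \<in> E \<and> Suc (dst w) = dst v" if v: "v \<in> V" "dst v > 0" for v
  proof -
    obtain k where k: "dst v = Suc k" using v(2) gr0_implies_Suc by blast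
    obtain w where w: "w \<in> P" "(v, w) \<in> R ^^ Suc k" using walk[OF v(1)] k by metis
    obtain y where y: "(v, y) \<in> R" "(y, w) \<in> R ^^ k" using relpow_Suc_D2[OF w(2)] by blast
    have yE: "{v, y} \<in> E" using y by (simp add: R_def)
    have yV: "y \<in> V" using subsetD[OF assms(2) yE] by (simp add: pair_in_nsets2)
    have "dst y \<le> k" using least[OF w(1) y(2)] .
    moreover obtain w' where w': "w' \<in> P" "(y, w') \<in> R ^^ dst y" using walk[OF yV] by blast
    have "dst v \<le> Suc (dst y)" using least[OF w'(1) relpow_Suc_I2[OF y(1) w'(2)]] .
    ultimately show ?thesis using yE yV k by (intro exI[of _ y]) auto
  qed
  define par where "par = (\<lambda>v. SOME w. w \<in> V \<and> {v, w} \<in> E \<and> Suc (dst w) = dst v)"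
  have "par v \<in> V \<and> {v, par v} \<in> E \<and> Suc (dst (par v)) = dst v"
    if "v \<in> V" "dst v > 0" for v
    using someI_ex[OF step[OF that]] unfolding par_def .
  with zero show ?thesis by (intro exI[of _ par] exI[of _ dst]) simp
qed

definition path_in :: "'a set \<Rightarrow> 'a set set \<Rightarrow> (nat \<Rightarrow> 'a) \<Rightarrow> nat \<Rightarrow> bool" where
  "path_in V E x m \<longleftrightarrow>
     x ` {..<m} \<subseteq> V \<and> inj_on x {..<m} \<and> (\<forall>i. Suc i < m \<longrightarrow> {x i, x (Suc i)} \<in> E)"

lemma path_in_rev:
  assumes "path_in V E x m"
  shows "path_in V E (\<lambda>i. x (m - 1 - i)) m"
    and "(\<lambda>i. x (m - 1 - i)) ` {..<m} = x ` {..<m}"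
proof -
  show im: "(\<lambda>i. x (m - 1 - i)) ` {..<m} = x ` {..<m}"
  proof
    show "x ` {..<m} \<subseteq> (\<lambda>i. x (m - 1 - i)) ` {..<m}"
    proof
      fix y assume "y \<in> x ` {..<m}"
      then obtain i where "i < m" "y = x i" by auto
      then show "y \<in> (\<lambda>i. x (m - 1 - i)) ` {..<m}"
        by (intro image_eqI[of _ _ "m - 1 - i"]) auto
    qed
  qed auto
  have "inj_on (\<lambda>i. x (m - 1 - i)) {..<m}"
  proof (rule inj_onI)
    fix i j assume ij: "i \<in> {..<m}" "j \<in> {..<m}" "x (m - 1 - i) = x (m - 1 - j)"
    then have "m - 1 - i = m - 1 - j"
      using assms unfolding path_in_def by (intro inj_onD[of x "{..<m}"]) auto
    then show "i = j" using ij by auto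
  qed
  moreover have "{x (m - 1 - i), x (m - 1 - Suc i)} \<in> E" if "Suc i < m" for i
  proof -
    have "Suc (m - 1 - Suc i) = m - 1 - i" using that by simp
    moreover have "{x (m - 1 - Suc i), x (Suc (m - 1 - Suc i))} \<in> E"
      using assms that unfolding path_in_def by auto
    ultimately show ?thesis by (simp add: insert_commute)
  qed
  ultimately show "path_in V E (\<lambda>i. x (m - 1 - i)) m"
    using im assms unfolding path_in_def by auto
qed

text \<open>\<open>idx v\<close> is the index at which the branch of \<open>v\<close> reaches the
  path. Adding the path edges to the forest gives a tree rooted at \<open>x 0\<close>, and the
  pipeline stops its \<open>i\<close>-th token at level \<open>i < h\<close>. This level lies on the
  path because the off-path agents of \<open>S\<close> sit on branches attached at index
  \<open>h\<close> or later. Branches attached earlier stay untouched, which the second pass relies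
  on.\<close>

lemma gather_half:
  fixes E :: "'a set set" and par :: "'a \<Rightarrow> 'a" and dst :: "'a \<Rightarrow> nat"
    and x :: "nat \<Rightarrow> 'a" and m h :: nat
  assumes fin: "finite V"
    and path: "path_in V E x m"
    and zero: "\<And>v. v \<in> V \<Longrightarrow> dst v = 0 \<longleftrightarrow> v \<in> x ` {..<m}"
    and par: "\<And>v. v \<in> V \<Longrightarrow> dst v > 0 \<Longrightarrow>
       par v \<in> V \<and> {v, par v} \<in> E \<and> Suc (dst (par v)) = dst v"
    and S: "S \<subseteq> V" "card S \<le> h"
    and idx: "\<And>v. v \<in> V \<Longrightarrow> idx v < m \<and> x (idx v) = (par ^^ dst v) v"
    and far: "\<And>v. v \<in> S \<Longrightarrow> v \<notin> x ` {..<m} \<Longrightarrow> idx v \<ge> h"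
  shows "\<exists>Ms. length Ms \<le> 3 * card V \<and> (\<forall>M\<in>set Ms. graph_matching E M) \<and>
    (\<forall>v\<in>S. fold swap_along Ms v \<in> x ` {..<m}) \<and>
    (\<forall>v\<in>V. v \<notin> x ` {..<m} \<longrightarrow> idx v < h \<longrightarrow> fold swap_along Ms v = v)"
proof -
  define P where "P = x ` {..<m}"
  define dep where "dep = (\<lambda>v. dst v + idx v)"
  define up where "up = (\<lambda>v. if dst v > 0 then par v else x (idx v - 1))"
  have inj: "inj_on x {..<m}" and PV: "P \<subseteq> V" using path by (auto simp: path_in_def P_def)
  have idxP: "idx (x i) = i" if "i < m" for i
  proof -
    have "x i \<in> V" "dst (x i) = 0" using that PV zero by (auto simp: P_def)
    then show ?thesis using idx[of "x i"] inj that by (auto simp: inj_on_def)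
  qed
  have idxpar: "idx (par v) = idx v" if "v \<in> V" "dst v > 0" for v
  proof -
    have "x (idx (par v)) = x (idx v)"
      using idx[of v] idx[of "par v"] par[OF that] that(1)
      by (metis comp_apply funpow_Suc_right)
    then show ?thesis using idx that par[OF that] inj by (auto simp: inj_on_def)
  qed
  have up: "up v \<in> V \<and> {v, up v} \<in> E \<and> Suc (dep (up v)) = dep v" if "v \<in> V" "dep v > 0" for v
  proof (cases "dst v > 0")
    case True
    then show ?thesis using par[OF that(1) True] idxpar[OF that(1) True] by (simp add: up_def dep_def)
  next
    case False
    then have v: "x (idx v) = v" "idx v < m" using idx[OF that(1)] by auto
    have i: "idx v > 0" using that(2) False by (simp add: dep_def)
    have "x (idx v - 1) \<in> P" using v by (auto simp: P_def)
    moreover have "{x (idx v - 1), x (Suc (idx v - 1))} \<in> E"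
      using path v i unfolding path_in_def by (metis Suc_pred' )
    moreover have "dst (x (idx v - 1)) = 0" using calculation(1) zero PV by (auto simp: P_def)
    moreover have "idx (x (idx v - 1)) = idx v - 1" using v by (intro idxP) auto
    ultimately show ?thesis using False v i PV
      by (auto simp: up_def dep_def insert_commute)
  qed
  have climb: "(up ^^ k) v \<in> V \<and> dep ((up ^^ k) v) = dep v - k" if "v \<in> V" "k \<le> dep v" for v k
    using that(2)
  proof (induction k)
    case (Suc k)
    then show ?case using up[of "(up ^^ k) v"] by auto
  qed (use that in simp)
  \<comment> \<open>The climb from \<open>v\<close> meets every level down to \<open>0\<close>, and
    different levels are different vertices. This supplies the depth bound of the pipeline.\<close>
  have depV: "dep v \<le> card V" if "v \<in> V" for v
  proof -
    have "{0..dep v} \<subseteq> dep ` V"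
    proof
      fix d assume "d \<in> {0..dep v}"
      then have "(up ^^ (dep v - d)) v \<in> V" "dep ((up ^^ (dep v - d)) v) = d"
        using climb[OF that, of "dep v - d"] by auto
      then show "d \<in> dep ` V" by (metis imageI)
    qed
    then have "Suc (dep v) \<le> card (dep ` V)" using card_mono[of "dep ` V" "{0..dep v}"] fin by simp
    then show ?thesis using card_image_le[OF fin, of dep] by linarith
  qed
  have off: "(up ^^ k) v \<in> V \<and> dst ((up ^^ k) v) = dst v - k \<and> idx ((up ^^ k) v) = idx v"
    if "v \<in> V" "k \<le> dst v" for v k
    using that(2)
  proof (induction k)
    case (Suc k)
    let ?w = "(up ^^ k) v"
    have "?w \<in> V" "dst ?w > 0" using Suc by auto
    moreover have "up ?w = par ?w" using calculation by (simp add: up_def)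
    ultimately show ?case using Suc par[of ?w] idxpar[of ?w] by auto
  qed (use that in simp)
  have on: "(up ^^ k) v \<in> P" if "v \<in> V" "dst v \<le> k" "k \<le> dep v" for v k
    using that(2,3)
  proof (induction k rule: dec_induct)
    case base
    have "dst ((up ^^ dst v) v) = 0" "(up ^^ dst v) v \<in> V" using off[OF that(1), of "dst v"] by auto
    then show ?case using zero by (simp add: P_def)
  next
    case (step k)
    let ?w = "(up ^^ k) v"
    have "?w \<in> P" using step by simp
    then have "dst ?w = 0" "?w \<in> V" using zero PV by (auto simp: P_def)
    then have "up ?w = x (idx ?w - 1)" "idx ?w < m" using idx[of ?w] by (auto simp: up_def)
    then show ?case by (auto simp: P_def)
  qed
  obtain ys where ys: "distinct ys" "set ys = S"
    using finite_distinct_list[OF finite_subset[OF S(1) fin]] by blast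
  define us where "us = sort_key dep ys"
  have us: "distinct us" "set us = S" "sorted (map dep us)" "length us = card S"
    using ys distinct_card[of ys] by (auto simp: us_def)
  have uS: "us ! i \<in> S" if "i < card S" for i using that us by (metis nth_mem)
  have uV: "us ! i \<in> V" if "i < card S" for i using uS[OF that] S by blast
  have srt: "dep (us ! i) \<le> dep (us ! j)" if "i \<le> j" "j < card S" for i j
    using us that by (auto simp: sorted_iff_nth_mono)
  \<comment> \<open>This puts the stopping level \<open>i\<close> on the path. If the index is below
    \<open>h\<close>, sorting by depth forces all tokens up to the \<open>i\<close>-th to start on
    the path, at distinct indices not exceeding that of the \<open>i\<close>-th.\<close>
  have room: "i \<le> idx (us ! i)" if "i < card S" for i
  proof (cases "idx (us ! i) \<ge> h")
    case True
    then show ?thesis using S that by simp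
  next
    case False
    then have "us ! i \<in> P" using far[OF uS[OF that]] by (auto simp: P_def)
    then have di: "dst (us ! i) = 0" using zero[OF uV[OF that]] by (simp add: P_def)
    have *: "dst (us ! k) = 0 \<and> idx (us ! k) \<le> idx (us ! i)" if "k \<le> i" for k
    proof -
      have k: "k < card S" using that \<open>i < card S\<close> by simp
      have le: "dep (us ! k) \<le> idx (us ! i)" using srt[OF that \<open>i < card S\<close>] di by (simp add: dep_def)
      then have "us ! k \<in> P" using False far[OF uS[OF k]] by (fastforce simp: P_def dep_def)
      then have "dst (us ! k) = 0" using zero[OF uV[OF k]] by (simp add: P_def)
      then show ?thesis using le by (simp add: dep_def)
    qed
    have "inj_on (\<lambda>k. idx (us ! k)) {..i}"
    proof (rule inj_onI)
      fix k l assume kl: "k \<in> {..i}" "l \<in> {..i}" "idx (us ! k) = idx (us ! l)"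
      have kS: "k < card S" "l < card S" using kl that by auto
      have "us ! k = x (idx (us ! k))" "us ! l = x (idx (us ! l))"
        using idx[OF uV[OF kS(1)]] idx[OF uV[OF kS(2)]] * kl(1,2) by (metis atMost_iff funpow_0)+
      then have "us ! k = us ! l" using kl(3) by metis
      then show "k = l" using us(1,4) kS by (simp add: nth_eq_iff_index_eq)
    qed
    then have "card {..i} \<le> card {..idx (us ! i)}"
      by (rule card_inj_on_le) (use * in auto)
    then show ?thesis by simp
  qed
  have injus: "inj_on ((!) us) {..<card S}"
    using us by (auto simp: inj_on_def nth_eq_iff_index_eq)
  have room': "i \<le> dep (us ! i)" if "i < card S" for i using room[OF that] by (simp add: dep_def)
  obtain Ms where Ms: "length Ms = 2 * card S + card V" "\<forall>M\<in>set Ms. graph_matching E M"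
    "\<And>i. i < card S \<Longrightarrow> fold swap_along Ms (us ! i) = (up ^^ (dep (us ! i) - i)) (us ! i)"
    "\<And>v. (\<And>i k. i < card S \<Longrightarrow> k \<le> dep (us ! i) - i \<Longrightarrow> v \<noteq> (up ^^ k) (us ! i)) \<Longrightarrow>
       fold swap_along Ms v = v"
    using pipelined_ascent[OF up depV uV injus srt[OF less_imp_le] room'] by blast
  show ?thesis
  proof (intro exI[of _ Ms] conjI ballI impI)
    have "card S \<le> card V" using S fin by (simp add: card_mono)
    then show "length Ms \<le> 3 * card V" using Ms by simp
    show "fold swap_along Ms v \<in> x ` {..<m}" if v: "v \<in> S" for v
    proof -
      obtain i where i: "i < card S" "us ! i = v" using v us by (metis in_set_conv_nth)
      have "(up ^^ (dep v - i)) v \<in> P"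
        using room[OF i(1)] i uV[OF i(1)] by (intro on) (auto simp: dep_def)
      then show ?thesis using Ms(3)[OF i(1)] i by (simp add: P_def)
    qed
    \<comment> \<open>Off the path a token keeps its \<open>idx\<close>, which is at least
      \<open>h\<close>, so no token passes through \<open>v\<close>.\<close>
    show "fold swap_along Ms v = v" if v: "v \<in> V" "v \<notin> x ` {..<m}" "idx v < h" for v
    proof (rule Ms(4))
      fix i k assume i: "i < card S" and k: "k \<le> dep (us ! i) - i"
      show "v \<noteq> (up ^^ k) (us ! i)"
      proof
        assume vk: "v = (up ^^ k) (us ! i)"
        show False
        proof (cases "k < dst (us ! i)")
          case True
          then have "idx v = idx (us ! i)" using off[OF uV[OF i], of k] vk by simp
          moreover have "us ! i \<notin> x ` {..<m}" using True zero[OF uV[OF i]] by auto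
          ultimately show False using far[OF uS[OF i]] v by simp
        next
          case False
          then have "v \<in> P" using on[OF uV[OF i], of k] k vk by simp
          then show False using v by (simp add: P_def)
        qed
      qed
    qed
  qed (use Ms(2) in blast)
qed

text \<open>One pass with the root at \<open>x 0\<close> fills the vertices \<open>x 0, x 1, \<dots>\<close>, so it serves only the agents whose
  branch leaves the path at index at least \<open>m div 2\<close>. A second pass along the reversed path serves the
  others.\<close>

lemma gather:
  fixes E :: "'a set set"
  assumes fin: "finite V" and E: "E \<subseteq> [V]\<^bsup>2\<^esup>" and con: "connected_graph V E"
    and path: "path_in V E x m" and S: "S \<subseteq> V" "card S \<le> m div 2" and m: "m > 0"
  obtains Ms where "length Ms \<le> 6 * card V" "\<forall>M\<in>set Ms. graph_matching E M"
    "\<And>v. v \<in> S \<Longrightarrow> fold swap_along Ms v \<in> x ` {..<m}"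
proof -
  define P where "P = x ` {..<m}"
  have P: "P \<subseteq> V" "P \<noteq> {}" using path m by (auto simp: path_in_def P_def)
  obtain par :: "'a \<Rightarrow> 'a" and dst :: "'a \<Rightarrow> nat" where
    zero: "\<And>v. v \<in> V \<Longrightarrow> dst v = 0 \<longleftrightarrow> v \<in> P" and
    par: "\<And>v. v \<in> V \<Longrightarrow> dst v > 0 \<Longrightarrow> par v \<in> V \<and> {v, par v} \<in> E \<and> Suc (dst (par v)) = dst v"
    using forest_to_set[OF con E P] by metis
  have base: "(par ^^ k) v \<in> V \<and> dst ((par ^^ k) v) = dst v - k" if "v \<in> V" "k \<le> dst v" for v k
    using that(2)
  proof (induction k)
    case (Suc k)
    then show ?case using par[of "(par ^^ k) v"] by auto
  qed (use that in simp)
  have "\<exists>i<m. x i = (par ^^ dst v) v" if "v \<in> V" for v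
    using base[OF that, of "dst v"] zero[of "(par ^^ dst v) v"] by (auto simp: P_def)
  then obtain idx where idx: "\<And>v. v \<in> V \<Longrightarrow> idx v < m \<and> x (idx v) = (par ^^ dst v) v"
    by metis
  define h where "h = m div 2"
  define S1 where "S1 = {v \<in> S. v \<in> P \<or> idx v \<ge> h}"
  have finS: "finite S" using S fin finite_subset by blast
  have S1: "S1 \<subseteq> V" "card S1 \<le> h"
    using S card_mono[OF finS, of S1] by (auto simp: S1_def h_def)
  have zero1: "\<And>v. v \<in> V \<Longrightarrow> dst v = 0 \<longleftrightarrow> v \<in> x ` {..<m}" using zero by (simp add: P_def)
  have far1: "idx v \<ge> h" if "v \<in> S1" "v \<notin> x ` {..<m}" for v
    using that by (auto simp: S1_def P_def)
  obtain Ms where Ms: "length Ms \<le> 3 * card V" "\<forall>M\<in>set Ms. graph_matching E M"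
    "\<And>v. v \<in> S1 \<Longrightarrow> fold swap_along Ms v \<in> P"
    "\<And>v. v \<in> V \<Longrightarrow> v \<notin> P \<Longrightarrow> idx v < h \<Longrightarrow> fold swap_along Ms v = v"
    using gather_half[OF fin path zero1 par S1 idx far1, folded P_def] by metis
  define S2 where "S2 = fold swap_along Ms ` S"
  define idx' where "idx' = (\<lambda>v. m - 1 - idx v)"
  note rev = path_in_rev[OF path]
  have S2: "S2 \<subseteq> V" "card S2 \<le> h"
    using fold_swap_along_in[OF Ms(2) E] S card_image_le[OF finS, of "fold swap_along Ms"]
    by (auto simp: S2_def h_def)
  have zero2: "\<And>v. v \<in> V \<Longrightarrow> dst v = 0 \<longleftrightarrow> v \<in> (\<lambda>i. x (m - 1 - i)) ` {..<m}"
    using zero1 unfolding rev(2) .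
  have idx2: "idx' v < m \<and> x (m - 1 - idx' v) = (par ^^ dst v) v" if "v \<in> V" for v
    using idx[OF that] m by (auto simp: idx'_def)
  \<comment> \<open>An agent still off the path was not in \<open>S1\<close>, so it had
    \<open>idx < h\<close> and has not moved. Its reversed index \<open>m - 1 - idx\<close> is then
    at least \<open>h = m div 2\<close>.\<close>
  have far2: "idx' v \<ge> h" if v: "v \<in> S2" "v \<notin> (\<lambda>i. x (m - 1 - i)) ` {..<m}" for v
  proof -
    obtain u where u: "u \<in> S" "v = fold swap_along Ms u" using v by (auto simp: S2_def)
    have vP: "v \<notin> P" using v(2) unfolding rev(2) P_def .
    then have "u \<notin> S1" using Ms(3) u by auto
    then have *: "u \<notin> P" "idx u < h" using u by (auto simp: S1_def)
    then have "v = u" using Ms(4)[of u] u S by auto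
    then show ?thesis using * by (simp add: idx'_def h_def)
  qed
  obtain Ns where Ns: "length Ns \<le> 3 * card V" "\<forall>M\<in>set Ns. graph_matching E M"
    "\<And>v. v \<in> S2 \<Longrightarrow> fold swap_along Ns v \<in> (\<lambda>i. x (m - 1 - i)) ` {..<m}"
    using gather_half[OF fin rev(1) zero2 par S2 idx2 far2] by metis
  show thesis
  proof (rule that[of "Ms @ Ns"])
    show "length (Ms @ Ns) \<le> 6 * card V" using Ms(1) Ns(1) by simp
    show "\<forall>M\<in>set (Ms @ Ns). graph_matching E M" using Ms(2) Ns(2) by auto
    show "fold swap_along (Ms @ Ns) v \<in> x ` {..<m}" if "v \<in> S" for v
      using Ns(3)[of "fold swap_along Ms v"] that unfolding rev(2) by (auto simp: S2_def)
  qed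
qed

section \<open>Rotation of a path\<close>

text \<open>Unfolding the path to a cycle of length \<open>2 m\<close> by \<open>F\<close> turns the alternating swaps into a uniform
  rotation: at time \<open>t\<close> the agent that starts at \<open>x i\<close> is at \<open>x (F ((c i + t) mod (2 * m)))\<close>. Two agents
  are adjacent when their cycle positions add up to \<open>2 m - 2\<close>.\<close>

lemma odd_even_rotation:
  fixes E :: "'a set set" and x :: "nat \<Rightarrow> 'a"
  assumes path: "path_in V E x m" and E: "E \<subseteq> [V]\<^bsup>2\<^esup>"
  shows "\<exists>Ms. length Ms = 2 * m \<and> (\<forall>M\<in>set Ms. graph_matching E M) \<and>
    (\<forall>a\<in>x ` {..<m}. \<forall>b\<in>x ` {..<m}. a \<noteq> b \<longrightarrow> acquainted E Ms a b) \<and>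
    (\<forall>a\<in>x ` {..<m}. x ` {..<m} \<subseteq> (\<lambda>t. agent_position Ms t a) ` {..2 * m})"
proof -
  define M where "M = (\<lambda>t::nat. {{x i, x (Suc i)} |i. Suc i < m \<and> even (i + t)})"
  define F where "F = (\<lambda>y::nat. if y < m then y else 2 * m - 1 - y)"
  \<comment> \<open>The even one of the two cycle positions \<open>i\<close> and
    \<open>2 * m - 1 - i\<close> over \<open>x i\<close>. Evenness gives the parity condition of
    \<open>step\<close>, under which the swaps move all agents in the same direction around the
    cycle.\<close>
  define c where "c = (\<lambda>i::nat. if even i then i else 2 * m - 1 - i)"
  define Ms where "Ms = map M [0..<2 * m]"
  have inj: "inj_on x {..<m}" using path by (simp add: path_in_def)
  have xeq: "x i = x j \<longleftrightarrow> i = j" if "i < m" "j < m" for i j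
    using inj that by (auto simp: inj_on_def)
  have gm: "graph_matching E (M t)" for t
    unfolding graph_matching_def
  proof
    show "M t \<subseteq> E" using path by (auto simp: M_def path_in_def)
    show "pairwise disjnt (M t)"
    proof (rule pairwiseI)
      fix e f assume "e \<in> M t" "f \<in> M t" and ne: "e \<noteq> f"
      then obtain i j where ij: "Suc i < m" "even (i + t)" "e = {x i, x (Suc i)}"
        "Suc j < m" "even (j + t)" "f = {x j, x (Suc j)}" by (auto simp: M_def)
      then have "i \<noteq> j" using ne by metis
      moreover have "i \<noteq> Suc j" "j \<noteq> Suc i" using ij by auto
      ultimately show "disjnt e f" using ij by (auto simp: disjnt_def xeq)
    qed
  qed
  have sw: "swap_along (M t) (x i) = x (Suc i)" "swap_along (M t) (x (Suc i)) = x i"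
    if "Suc i < m" "even (i + t)" for i t
  proof -
    have "{x i, x (Suc i)} \<in> M t" using that by (auto simp: M_def)
    moreover from this have "{x (Suc i), x i} \<in> M t" by (metis insert_commute)
    ultimately show "swap_along (M t) (x i) = x (Suc i)" "swap_along (M t) (x (Suc i)) = x i"
      using gm[of t] by (auto simp: graph_matching_def intro: swap_along_eq)
  qed
  have stay: "swap_along (M t) (x i) = x i"
    if "i < m" "Suc i < m \<Longrightarrow> odd (i + t)" "i > 0 \<Longrightarrow> even (i + t)" for i t
  proof (rule swap_along_notin, rule notI)
    assume "x i \<in> \<Union>(M t)"
    then obtain j where j: "Suc j < m" "even (j + t)" "x i \<in> {x j, x (Suc j)}"
      by (auto simp: M_def)
    then have "i = j \<or> i = Suc j" using that(1) xeq by auto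
    then show False using j that by auto
  qed
  have step: "swap_along (M t) (x (F (y mod (2 * m)))) = x (F (Suc y mod (2 * m)))"
    if "even (y + t)" "m > 0" for y t :: nat
  proof -
    define z where "z = y mod (2 * m)"
    have zm: "z < 2 * m" using that by (simp add: z_def)
    have "even z \<longleftrightarrow> even y" unfolding z_def by (intro dvd_mod_iff) simp
    then have ez: "even (z + t)" using that by simp
    have sy: "Suc y mod (2 * m) = (if Suc z = 2 * m then 0 else Suc z)"
      by (simp add: z_def mod_Suc)
    \<comment> \<open>The agent moves forward, rests at the far end, moves back, or rests at
      \<open>x 0\<close>. Each end vertex has two consecutive cycle positions, hence the pause of
      one round.\<close>
    consider "Suc z < m" | "Suc z = m" | "Suc z > m" "Suc z < 2 * m" | "Suc z = 2 * m" using zm by linarith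
    then have "swap_along (M t) (x (F z)) = x (F (if Suc z = 2 * m then 0 else Suc z))"
    proof cases
      case 1
      then show ?thesis using sw(1)[of z t] ez by (simp add: F_def)
    next
      case 2
      then show ?thesis using stay[of z t] ez by (auto simp: F_def)
    next
      case 3
      define w where "w = 2 * m - 1 - Suc z"
      have w: "Suc w < m" "F z = Suc w" "F (Suc z) = w" using 3 by (auto simp: F_def w_def)
      have "w + z + 2 = 2 * m" using 3 by (simp add: w_def)
      then have "even (w + z)" by presburger
      then have "even (w + t)" using ez by presburger
      then show ?thesis using sw(2)[of w t] w 3 by simp
    next
      case 4
      have "z \<ge> m" "F z = 0" "F 0 = 0" using 4 that by (auto simp: F_def)
      moreover have "odd (0 + t)" using ez 4 by presburger
      ultimately show ?thesis using stay[of 0 t] 4 that by auto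
    qed
    then show ?thesis unfolding sy z_def .
  qed
  have ec: "even (c i)" if "i < m" for i using that by (auto simp: c_def)
  have cl: "c i < 2 * m" "F (c i) = i" if "i < m" for i using that by (auto simp: c_def F_def)
  have pos: "agent_position Ms t (x i) = x (F ((c i + t) mod (2 * m)))"
    if i: "i < m" and t: "t \<le> 2 * m" for i t
    using t
  proof (induction t)
    case 0
    then show ?case using cl[OF i] by (simp add: agent_position_def)
  next
    case (Suc t)
    have m0: "m > 0" using i by simp
    have "agent_position Ms (Suc t) (x i) = swap_along (M t) (x (F ((c i + t) mod (2 * m))))"
      using Suc by (subst agent_position_Suc) (auto simp: Ms_def)
    also have "\<dots> = x (F (Suc (c i + t) mod (2 * m)))"
      using ec[OF i] m0 by (intro step) auto
    finally show ?case by simp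
  qed
  have meet: "acquainted E Ms (x i) (x j)" if i: "i < m" and j: "j < m" and ne: "i \<noteq> j" for i j
  proof -
    define s where "s = (c i + c j) div 2"
    have s: "c i + c j = 2 * s" using ec[OF i] ec[OF j] by (simp add: s_def)
    \<comment> \<open>Since \<open>c i + c j = 2 * s\<close>, adding \<open>2 * t\<close> brings the
      sum of the two cycle positions to \<open>2 * m - 2\<close> modulo
      \<open>2 * m\<close>.\<close>
    define t where "t = m - 1 - s mod m"
    have sm: "s mod m < m" using i by simp
    have "(c i + t) + (c j + t) = 2 * s + 2 * (m - 1 - s mod m)" using s by (simp add: t_def)
    also have "\<dots> = 2 * (m * (s div m)) + (2 * m - 2)"
      using sm mult_div_mod_eq[of m s] by linarith
    also have "\<dots> = 2 * m * (s div m) + (2 * m - 2)" by (simp add: mult.assoc)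
    finally have sum: "(c i + t) + (c j + t) = 2 * m * (s div m) + (2 * m - 2)" .
    define y where "y = (c i + t) mod (2 * m)"
    define z where "z = (c j + t) mod (2 * m)"
    have yz: "y < 2 * m" "z < 2 * m" using i by (auto simp: y_def z_def)
    have "(y + z) mod (2 * m) = ((c i + t) + (c j + t)) mod (2 * m)"
      by (simp add: y_def z_def mod_simps)
    also have "\<dots> = (2 * m - 2) mod (2 * m)" unfolding sum by (rule mod_mult_self4)
    also have "\<dots> = 2 * m - 2" using i by (intro mod_less) simp
    finally have yzm: "(y + z) mod (2 * m) = 2 * m - 2" .
    \<comment> \<open>Needed twice: a sum of \<open>4 * m - 2\<close> would force
      \<open>y = z = 2 * m - 1\<close>, and with sum \<open>2 * m - 2\<close> the case
      \<open>y = z = m - 1\<close> would give one vertex instead of an edge.\<close>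
    have "y \<noteq> z"
    proof
      assume "y = z"
      then have "c i mod (2 * m) = c j mod (2 * m)"
        unfolding y_def z_def nat_mod_eq_iff by (simp add: ac_simps)
      then have "c i = c j" using cl(1) i j by simp
      then show False using cl(2) i j ne by metis
    qed
    have "y + z = 2 * m - 2"
    proof (cases "y + z < 2 * m")
      case False
      then have "y + z - 2 * m = 2 * m - 2"
        using yzm yz by (simp add: le_mod_geq mod_less)
      then show ?thesis using yz False \<open>y \<noteq> z\<close> by linarith
    qed (use yzm in simp)
    then have yz2: "y + z + 2 = 2 * m" using i by simp
    have tl: "t \<le> 2 * m" by (simp add: t_def)
    have "{x (F y), x (F z)} \<in> E"
    proof (cases "y < z")
      case True
      then have "F y = y" "F z = Suc y" "Suc y < m" using yz2 by (auto simp: F_def)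
      then show ?thesis using path by (simp add: path_in_def)
    next
      case False
      then have "F z = z" "F y = Suc z" "Suc z < m" using yz2 \<open>y \<noteq> z\<close> by (auto simp: F_def)
      then have "{x (F z), x (F y)} \<in> E" using path by (simp add: path_in_def)
      then show ?thesis by (metis insert_commute)
    qed
    then have "{agent_position Ms t (x i), agent_position Ms t (x j)} \<in> E"
      using pos[OF i tl] pos[OF j tl] by (simp add: y_def z_def)
    then show ?thesis unfolding acquainted_def using tl by (intro exI[of _ t]) (simp add: Ms_def)
  qed
  have visit: "x k \<in> (\<lambda>t. agent_position Ms t (x i)) ` {..2 * m}" if i: "i < m" and k: "k < m" for i k
  proof -
    define t where "t = (k + (2 * m - c i)) mod (2 * m)"
    have "(c i + t) mod (2 * m) = (c i + (k + (2 * m - c i))) mod (2 * m)"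
      by (simp add: t_def mod_simps)
    also have "c i + (k + (2 * m - c i)) = k + 2 * m" using cl(1)[OF i] by simp
    also have "(k + 2 * m) mod (2 * m) = k" using k by simp
    finally have "(c i + t) mod (2 * m) = k" .
    moreover have "t \<le> 2 * m" using i by (simp add: t_def less_imp_le)
    ultimately have "agent_position Ms t (x i) = x k" "t \<le> 2 * m" using pos[OF i] k by (auto simp: F_def)
    then show ?thesis by (metis atMost_iff imageI)
  qed
  have "length Ms = 2 * m" "\<forall>M\<in>set Ms. graph_matching E M" using gm by (auto simp: Ms_def)
  moreover have "\<forall>a\<in>x ` {..<m}. \<forall>b\<in>x ` {..<m}. a \<noteq> b \<longrightarrow> acquainted E Ms a b"
    using meet by auto
  moreover have "\<forall>a\<in>x ` {..<m}. x ` {..<m} \<subseteq> (\<lambda>t. agent_position Ms t a) ` {..2 * m}"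
    using visit by blast
  ultimately show ?thesis by blast
qed

section \<open>Schedules for families of agent sets\<close>

lemma acquainted_append_right:
  "acquainted E Ms a b \<Longrightarrow> acquainted E (Ms @ Ns) a b"
  unfolding acquainted_def by (metis agent_position_append_left le_add1 le_trans length_append)

lemma acquainted_append_left:
  assumes "acquainted E Ns (fold swap_along Ms a) (fold swap_along Ms b)"
  shows "acquainted E (Ms @ Ns) a b"
proof -
  obtain t where t: "t \<le> length Ns"
    "{agent_position Ns t (fold swap_along Ms a), agent_position Ns t (fold swap_along Ms b)} \<in> E"
    using assms by (auto simp: acquainted_def)
  then show ?thesis unfolding acquainted_def
    by (intro exI[of _ "length Ms + t"]) (simp add: agent_position_append)
qed

definition visited :: "'a set set list \<Rightarrow> 'a \<Rightarrow> 'a set" where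
  "visited Ms a = (\<lambda>t. agent_position Ms t a) ` {..length Ms}"

lemma visited_append_right: "visited Ms a \<subseteq> visited (Ms @ Ns) a"
proof
  fix v assume "v \<in> visited Ms a"
  then obtain t where "t \<le> length Ms" "v = agent_position Ms t a" by (auto simp: visited_def)
  then show "v \<in> visited (Ms @ Ns) a" unfolding visited_def
    by (intro image_eqI[of _ _ t]) (simp_all add: agent_position_append_left)
qed

lemma visited_append_left: "visited Ns (fold swap_along Ms a) \<subseteq> visited (Ms @ Ns) a"
proof
  fix v assume "v \<in> visited Ns (fold swap_along Ms a)"
  then obtain t where "t \<le> length Ns" "v = agent_position Ns t (fold swap_along Ms a)"
    by (auto simp: visited_def)
  then show "v \<in> visited (Ms @ Ns) a" unfolding visited_def
    by (intro image_eqI[of _ _ "length Ms + t"]) (simp_all add: agent_position_append)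
qed

text \<open>The acquaintances settle pairs inside a block. The visits to \<open>P\<close> later
  supply many distinct vertex pairs for agents of different blocks.\<close>

definition serves :: "'a set set \<Rightarrow> 'a set \<Rightarrow> 'a set set list \<Rightarrow> 'a set \<Rightarrow> bool" where
  "serves E P Ms S \<longleftrightarrow>
     (\<forall>a\<in>S. P \<subseteq> visited Ms a) \<and> (\<forall>a\<in>S. \<forall>b\<in>S. a \<noteq> b \<longrightarrow> acquainted E Ms a b)"

lemma serves_append_right: "serves E P Ms S \<Longrightarrow> serves E P (Ms @ Ns) S"
  unfolding serves_def using visited_append_right acquainted_append_right by fast

lemma serves_append_left:
  assumes "serves E P Ns (fold swap_along Ms ` S)" "inj (fold swap_along Ms)"
  shows "serves E P (Ms @ Ns) S"
  unfolding serves_def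
proof (intro conjI ballI impI)
  fix a assume "a \<in> S"
  then have "P \<subseteq> visited Ns (fold swap_along Ms a)" using assms(1) by (auto simp: serves_def)
  then show "P \<subseteq> visited (Ms @ Ns) a" using visited_append_left by fast
next
  fix a b assume ab: "a \<in> S" "b \<in> S" "a \<noteq> b"
  then have "fold swap_along Ms a \<noteq> fold swap_along Ms b" using assms(2) by (simp add: inj_eq)
  then show "acquainted E (Ms @ Ns) a b"
    using ab assms(1) by (intro acquainted_append_left) (simp add: serves_def)
qed

text \<open>Gathering takes at most \<open>6 * card V\<close> rounds and the rotation
  \<open>2 * m\<close>, where \<open>m \<le> card V\<close>.\<close>

lemma serve_small_set:
  fixes E :: "'a set set"
  assumes fin: "finite V" and E: "E \<subseteq> [V]\<^bsup>2\<^esup>" and con: "connected_graph V E"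
    and path: "path_in V E x m" and m: "m > 0" and S: "S \<subseteq> V" "card S \<le> m div 2"
  shows "\<exists>Ms. length Ms \<le> 8 * card V \<and> (\<forall>M\<in>set Ms. graph_matching E M) \<and>
    serves E (x ` {..<m}) Ms S"
proof -
  obtain Ms where Ms: "length Ms \<le> 6 * card V" "\<forall>M\<in>set Ms. graph_matching E M"
    "\<And>v. v \<in> S \<Longrightarrow> fold swap_along Ms v \<in> x ` {..<m}"
    using gather[OF fin E con path S m] by metis
  obtain Ns where Ns: "length Ns = 2 * m" "\<forall>M\<in>set Ns. graph_matching E M"
    "\<forall>a\<in>x ` {..<m}. \<forall>b\<in>x ` {..<m}. a \<noteq> b \<longrightarrow> acquainted E Ns a b"
    "\<forall>a\<in>x ` {..<m}. x ` {..<m} \<subseteq> (\<lambda>t. agent_position Ns t a) ` {..2 * m}"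
    using odd_even_rotation[OF path E] by metis
  have "serves E (x ` {..<m}) Ns (x ` {..<m})"
    using Ns unfolding serves_def visited_def by simp
  then have "serves E (x ` {..<m}) Ns (fold swap_along Ms ` S)"
    using Ms(3) unfolding serves_def by (simp add: subset_iff image_iff) metis
  then have "serves E (x ` {..<m}) (Ms @ Ns) S"
    using inj_fold_swap_along[OF Ms(2) E] by (rule serves_append_left)
  moreover have "m \<le> card V"
    using path card_mono[OF fin, of "x ` {..<m}"] by (auto simp: path_in_def card_image)
  ultimately show ?thesis using Ms(1,2) Ns(1,2) by (intro exI[of _ "Ms @ Ns"]) auto
qed

text \<open>Each further schedule is built for the current positions of the agents of
  \<open>S\<close>. These form a set that is no larger, and goals reached earlier survive
  appending.\<close>

lemma serve_family:
  fixes E :: "'a set set"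
  assumes fin: "finite V" and E: "E \<subseteq> [V]\<^bsup>2\<^esup>" and con: "connected_graph V E"
    and path: "path_in V E x m" and m: "m > 0"
    and Ss: "\<And>S. S \<in> set Ss \<Longrightarrow> S \<subseteq> V \<and> card S \<le> m div 2"
  shows "\<exists>Ms. length Ms \<le> 8 * card V * length Ss \<and> (\<forall>M\<in>set Ms. graph_matching E M) \<and>
    (\<forall>S\<in>set Ss. serves E (x ` {..<m}) Ms S)"
  using Ss
proof (induction Ss rule: rev_induct)
  case (snoc S Ss)
  obtain Ms where Ms: "length Ms \<le> 8 * card V * length Ss" "\<forall>M\<in>set Ms. graph_matching E M"
    "\<forall>S\<in>set Ss. serves E (x ` {..<m}) Ms S"
    using snoc by (metis UnCI set_append)
  have S: "S \<subseteq> V" "card S \<le> m div 2" using snoc.prems[of S] by auto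
  have "fold swap_along Ms ` S \<subseteq> V" using S fold_swap_along_in[OF Ms(2) E] by auto
  moreover have "card (fold swap_along Ms ` S) \<le> m div 2"
    using S card_image_le[OF finite_subset[OF S(1) fin], of "fold swap_along Ms"] by linarith
  ultimately obtain Ns where Ns: "length Ns \<le> 8 * card V" "\<forall>M\<in>set Ns. graph_matching E M"
    "serves E (x ` {..<m}) Ns (fold swap_along Ms ` S)"
    using serve_small_set[OF fin E con path m] by metis
  have "serves E (x ` {..<m}) (Ms @ Ns) T" if "T \<in> set Ss" for T
    using Ms(3) that by (intro serves_append_right) simp
  then have "\<forall>T\<in>set (Ss @ [S]). serves E (x ` {..<m}) (Ms @ Ns) T"
    using serves_append_left[OF Ns(3) inj_fold_swap_along[OF Ms(2) E]] by simp
  then show ?case using Ms(1,2) Ns(1,2)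
    by (intro exI[of _ "Ms @ Ns"]) (auto simp: algebra_simps)
qed simp

text \<open>Divide the agents into a bounded number of groups of size at most
  \<open>m div 4\<close>. Any two agents lie in the union of two groups, and each such union is
  small enough to be served.\<close>

lemma acquaintance_via_long_path:
  fixes E :: "'a set set"
  assumes fin: "finite V" and E: "E \<subseteq> [V]\<^bsup>2\<^esup>" and con: "connected_graph V E"
    and path: "path_in V E x m" and m: "m \<ge> 4" "card V \<le> 3 * m"
  shows "\<exists>Ms. length Ms \<le> 4000 * card V \<and> acquaintance_strategy V E Ms \<and>
    (\<forall>a\<in>V. x ` {..<m} \<subseteq> visited Ms a)"
proof -
  define n where "n = card V"
  define g where "g = m div 4"
  \<comment> \<open>Hence \<open>card V \<le> 3 * m \<le> 21 * g\<close>, and the group numbers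
    \<open>f v div g\<close> stay below \<open>22\<close>.\<close>
  have "m \<le> 7 * (m div 4)" "2 * (m div 4) \<le> m div 2" using m(1) by presburger+
  then have g: "g > 0" "n \<le> 21 * g" "2 * g \<le> m div 2" using m by (auto simp: g_def n_def)
  obtain f where f: "bij_betw f V {0..<n}" using ex_bij_betw_finite_nat[OF fin] n_def by blast
  define G where "G = (\<lambda>i::nat. {v \<in> V. f v div g = i})"
  have cG: "card (G i) \<le> g" for i
  proof -
    have "card (G i) \<le> card {i * g..<i * g + g}"
    proof (rule card_inj_on_le)
      show "inj_on f (G i)" using f by (auto simp: bij_betw_def G_def inj_on_def)
      show "f ` G i \<subseteq> {i * g..<i * g + g}"
        using g by (auto simp: G_def dividend_less_div_times div_times_less_eq_dividend)
          (metis add.commute dividend_less_div_times)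
    qed simp
    then show ?thesis by simp
  qed
  \<comment> \<open>The \<open>22 * 22 = 484\<close> unions cost at most
    \<open>8 * 484 = 3872\<close> times \<open>card V\<close> rounds. The case \<open>i = j\<close>
    covers two agents of one group.\<close>
  define Ss where "Ss = map (\<lambda>(i, j). G i \<union> G j) (List.product [0..<22] [0..<22])"
  have lS: "length Ss = 484" by (simp add: Ss_def)
  have sS: "S \<subseteq> V \<and> card S \<le> m div 2" if S: "S \<in> set Ss" for S
  proof -
    obtain i j where ij: "S = G i \<union> G j" using S by (auto simp: Ss_def)
    have "card S \<le> card (G i) + card (G j)" unfolding ij by (rule card_Un_le)
    also have "\<dots> \<le> m div 2" using cG[of i] cG[of j] g by linarith
    finally show ?thesis using ij by (auto simp: G_def)
  qed
  obtain Ms where Ms: "length Ms \<le> 8 * card V * length Ss" "\<forall>M\<in>set Ms. graph_matching E M"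
    "\<forall>S\<in>set Ss. serves E (x ` {..<m}) Ms S"
    using serve_family[OF fin E con path _ sS, of Ss] m by auto
  have cover: "\<exists>S\<in>set Ss. a \<in> S \<and> b \<in> S" if ab: "a \<in> V" "b \<in> V" for a b
  proof -
    have small: "f v div g < 22" if "v \<in> V" for v
    proof -
      have "f v < n" using f that by (auto simp: bij_betw_def)
      then have "f v < 22 * g" using g by linarith
      then show ?thesis using g by (simp add: less_mult_imp_div_less)
    qed
    have "G (f a div g) \<union> G (f b div g) \<in> set Ss"
      using small[OF ab(1)] small[OF ab(2)] unfolding Ss_def
      by (auto intro!: image_eqI[of _ _ "(f a div g, f b div g)"])
    moreover have "a \<in> G (f a div g)" "b \<in> G (f b div g)" using ab by (auto simp: G_def)
    ultimately show ?thesis by (metis UnCI)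
  qed
  have "x ` {..<m} \<subseteq> visited Ms a" if "a \<in> V" for a
    using cover[OF that that] Ms(3) unfolding serves_def by metis
  moreover have "acquainted E Ms a b" if "a \<in> V" "b \<in> V" "a \<noteq> b" for a b
    using cover[OF that(1,2)] Ms(3) that(3) unfolding serves_def by metis
  ultimately show ?thesis using Ms(1,2) lS
    by (intro exI[of _ Ms]) (auto simp: acquaintance_strategy_def)
qed

section \<open>Long paths, cuts and blocks\<close>

lemma expander_has_long_path:
  fixes E :: "'a set set"
  assumes fin: "finite V" and E: "E \<subseteq> [V]\<^bsup>2\<^esup>"
    and joined: "\<And>X Y. X \<subseteq> V \<Longrightarrow> Y \<subseteq> V \<Longrightarrow> X \<inter> Y = {} \<Longrightarrow> card X = k \<Longrightarrow> card Y = k \<Longrightarrow>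
       \<exists>x\<in>X. \<exists>y\<in>Y. {x, y} \<in> E"
  shows "\<exists>x m. path_in V E x m \<and> card V + 2 \<le> m + 2 * k"
proof -
  define n where "n = card V"
  \<comment> \<open>depth-first search with stack \<open>ps\<close>, unvisited vertices \<open>U\<close> and finished vertices \<open>D\<close>;
    each step decreases \<open>card U - card D\<close> by one, from \<open>n\<close> to \<open>0\<close>\<close>
  define state where "state = (\<lambda>ps U D. distinct ps \<and> set ps \<union> U \<union> D = V \<and>
    set ps \<inter> U = {} \<and> set ps \<inter> D = {} \<and> U \<inter> D = {} \<and>
    (\<forall>i. Suc i < length ps \<longrightarrow> {ps ! i, ps ! Suc i} \<in> E) \<and>
    (\<forall>u\<in>U. \<forall>d\<in>D. {u, d} \<notin> E))"
  have "\<exists>ps U D. state ps U D \<and> card U + t = card D + n" if "t \<le> n" for t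
    using that
  proof (induction t)
    case 0
    show ?case by (intro exI[of _ "[]"] exI[of _ V] exI[of _ "{}"]) (simp add: state_def n_def)
  next
    case (Suc t)
    then obtain ps U D where st: "state ps U D" "card U + t = card D + n" by auto
    have finUD: "finite U" "finite D" using st(1) fin unfolding state_def by (auto intro: finite_subset)
    have push: ?case if u: "u \<in> U" "ps \<noteq> [] \<Longrightarrow> {u, hd ps} \<in> E" for u
    proof -
      have "{(u # ps) ! i, (u # ps) ! Suc i} \<in> E" if "Suc i < length (u # ps)" for i
      proof (cases i)
        case 0
        then show ?thesis using that u(2) by (cases ps) auto
      next
        case (Suc j)
        then show ?thesis using that st(1) by (simp add: state_def)
      qed
      then have "state (u # ps) (U - {u}) D" using st(1) u unfolding state_def by auto
      moreover have "card (U - {u}) + Suc t = card D + n"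
        using st(2) u(1) finUD card_Suc_Diff1[of U u] by simp
      ultimately show ?thesis by blast
    qed
    have "U \<noteq> {}" using st(2) Suc.prems by auto
    show ?case
    proof (cases ps)
      case Nil
      then show ?thesis using push \<open>U \<noteq> {}\<close> by auto
    next
      case (Cons v vs)
      show ?thesis
      proof (cases "\<exists>u\<in>U. {u, v} \<in> E")
        case True
        then show ?thesis using push Cons by auto
      next
        case False
        have "{vs ! i, vs ! Suc i} \<in> E" if "Suc i < length vs" for i
        proof -
          have "\<forall>i. Suc i < length ps \<longrightarrow> {ps ! i, ps ! Suc i} \<in> E" using st(1) by (simp add: state_def)
          from this[rule_format, of "Suc i"] show ?thesis using that Cons by simp
        qed
        then have "state vs U (insert v D)" using st(1) False unfolding state_def Cons by auto
        moreover have "v \<notin> D" using st(1) Cons by (auto simp: state_def)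
        ultimately show ?thesis using st(2) finUD
          by (intro exI[of _ vs] exI[of _ U] exI[of _ "insert v D"]) simp
      qed
    qed
  qed
  \<comment> \<open>With \<open>n\<close> steps done, \<open>U\<close> and \<open>D\<close> have
    equal size and no edge between them, so both have at most \<open>k - 1\<close> vertices. The
    stack is a path on all remaining vertices, at least \<open>n - 2 * (k - 1)\<close> of
    them.\<close>
  from this[of n] obtain ps U D where st: "state ps U D" "card U = card D" by auto
  have finUD: "finite U" "finite D" using st(1) fin unfolding state_def by (auto intro: finite_subset)
  have "card D < k"
  proof (rule ccontr)
    assume "\<not> card D < k"
    then obtain X Y where XY: "X \<subseteq> U" "card X = k" "Y \<subseteq> D" "card Y = k"
      using obtain_subset_with_card_n[of k U] obtain_subset_with_card_n[of k D] st(2) by (metis not_less)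
    have "\<exists>x\<in>X. \<exists>y\<in>Y. {x, y} \<in> E"
      using XY st(1) unfolding state_def by (intro joined) auto
    then show False using st(1) XY unfolding state_def by fast
  qed
  moreover have "n = length ps + card U + card D"
  proof -
    have "V = set ps \<union> (U \<union> D)" "set ps \<inter> (U \<union> D) = {}" "U \<inter> D = {}" "distinct ps"
      using st(1) by (auto simp: state_def)
    then show ?thesis unfolding n_def using finUD by (simp add: card_Un_disjoint distinct_card)
  qed
  moreover have "path_in V E ((!) ps) (length ps)"
    using st(1) unfolding state_def path_in_def by (auto simp: inj_on_nth)
  ultimately show ?thesis using st(2) n_def
    by (intro exI[of _ "(!) ps"] exI[of _ "length ps"]) simp
qed

section \<open>Cuts and connectedness\<close>

lemma disconnected_cut:
  fixes E :: "'a set set"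
  assumes fin: "finite V" "V \<noteq> {}" and E: "E \<subseteq> [V]\<^bsup>2\<^esup>" and dis: "\<not> connected_graph V E"
  shows "\<exists>S\<subseteq>V. S \<noteq> {} \<and> 2 * card S \<le> card V \<and> (\<forall>u\<in>S. \<forall>v\<in>V - S. {u, v} \<notin> E)"
proof -
  define R where "R = {(x, y). {x, y} \<in> E}"
  obtain u v where uv: "u \<in> V" "v \<in> V" "(u, v) \<notin> R\<^sup>*"
    using dis fin unfolding connected_graph_def R_def by auto
  define S where "S = {w \<in> V. (u, w) \<in> R\<^sup>*}"
  have S: "S \<subseteq> V" "u \<in> S" "v \<in> V - S" using uv by (auto simp: S_def)
  have cut: "{a, b} \<notin> E" "{b, a} \<notin> E" if "a \<in> S" "b \<in> V - S" for a b
  proof -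
    have "(a, b) \<notin> R"
    proof
      assume "(a, b) \<in> R"
      then have "(u, b) \<in> R\<^sup>*" using that(1) unfolding S_def by (auto intro: rtrancl.rtrancl_into_rtrancl)
      then show False using that(2) by (simp add: S_def)
    qed
    then show "{a, b} \<notin> E" "{b, a} \<notin> E" by (simp_all add: R_def insert_commute)
  qed
  \<comment> \<open>Either the component of \<open>u\<close> or its complement contains at most half
    of the vertices.\<close>
  have "card S + card (V - S) = card V"
    using S fin by (metis card_Diff_subset card_mono finite_subset le_add_diff_inverse)
  then consider "2 * card S \<le> card V" | "2 * card (V - S) \<le> card V" by linarith
  then show ?thesis
  proof cases
    case 1
    then show ?thesis using S cut by (intro exI[of _ S]) auto
  next
    case 2
    have "V - (V - S) = S" using S by blast
    then show ?thesis using 2 S(3) cut by (intro exI[of _ "V - S"]) auto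
  qed
qed

text \<open>Swaps keep an agent in the component of its initial vertex, and two agents who get
  acquainted are then on adjacent vertices; so all initial vertices lie in one component.\<close>

lemma strategy_imp_connected:
  fixes E :: "'a set set"
  assumes E: "E \<subseteq> [V]\<^bsup>2\<^esup>" and V: "V \<noteq> {}" and st: "acquaintance_strategy V E Ms"
  shows "connected_graph V E"
proof -
  define R where "R = {(x, y). {x, y} \<in> E}"
  have symR: "sym R" by (auto simp: sym_def R_def insert_commute)
  have sw: "(a, swap_along M a) \<in> R\<^sup>*" if M: "graph_matching E M" for M a
  proof (rule swap_along_cases[OF M E, of a])
    assume "{a, swap_along M a} \<in> M"
    then have "(a, swap_along M a) \<in> R" using M by (auto simp: graph_matching_def R_def)
    then show ?thesis by (rule r_into_rtrancl)
  qed simp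
  have "(a, fold swap_along Ns a) \<in> R\<^sup>*" if "\<forall>M\<in>set Ns. graph_matching E M" for Ns a
    using that
  proof (induction Ns arbitrary: a)
    case (Cons M Ns)
    have "(a, swap_along M a) \<in> R\<^sup>*" using Cons.prems by (intro sw) simp
    also have "(swap_along M a, fold swap_along Ns (swap_along M a)) \<in> R\<^sup>*"
      using Cons.prems by (intro Cons.IH) simp
    finally show ?case by simp
  qed simp
  then have pos: "(a, agent_position Ms t a) \<in> R\<^sup>*" for t a
    unfolding agent_position_def
    using st set_take_subset[of t Ms] by (auto simp: acquaintance_strategy_def)
  have "(a, b) \<in> R\<^sup>*" if ab: "a \<in> V" "b \<in> V" for a b
  proof (cases "a = b")
    case False
    then obtain t where "{agent_position Ms t a, agent_position Ms t b} \<in> E"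
      using st ab unfolding acquaintance_strategy_def acquainted_def by metis
    then have "(agent_position Ms t a, agent_position Ms t b) \<in> R" by (simp add: R_def)
    moreover have "(agent_position Ms t b, b) \<in> R\<^sup>*"
      using pos[of b t] sym_rtrancl[OF symR] by (meson symD)
    ultimately show ?thesis using pos[of a t] by (meson rtrancl.rtrancl_into_rtrancl rtrancl_trans)
  qed simp
  then show ?thesis using V by (simp add: connected_graph_def R_def)
qed

section \<open>Parallel strategies on disjoint blocks\<close>

lemma swap_along_Union_blocks:
  assumes N: "\<And>B. B \<in> \<B> \<Longrightarrow> graph_matching (E \<inter> [B]\<^bsup>2\<^esup>) (N B)"
    and dis: "pairwise disjnt \<B>"
  shows "graph_matching E (\<Union>B\<in>\<B>. N B)"
    and "B \<in> \<B> \<Longrightarrow> v \<in> B \<Longrightarrow> swap_along (\<Union>B\<in>\<B>. N B) v = swap_along (N B) v"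
proof -
  have sub: "e \<subseteq> B" if "B \<in> \<B>" "e \<in> N B" for e B
    using N[OF that(1)] that(2) by (auto simp: graph_matching_def nsets_def)
  show gm: "graph_matching E (\<Union>B\<in>\<B>. N B)"
    unfolding graph_matching_def
  proof
    show "(\<Union>B\<in>\<B>. N B) \<subseteq> E" using N by (fastforce simp: graph_matching_def)
    show "pairwise disjnt (\<Union>B\<in>\<B>. N B)"
    proof (rule pairwiseI)
      fix e f assume "e \<in> (\<Union>B\<in>\<B>. N B)" "f \<in> (\<Union>B\<in>\<B>. N B)" and ne: "e \<noteq> f"
      then obtain B C where BC: "B \<in> \<B>" "e \<in> N B" "C \<in> \<B>" "f \<in> N C" by auto
      show "disjnt e f"
      proof (cases "B = C")
        case True
        then show ?thesis using N[OF BC(1)] BC ne by (auto simp: graph_matching_def pairwise_def)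
      next
        case False
        then have "disjnt B C" using dis BC by (auto simp: pairwise_def)
        then show ?thesis using sub[OF BC(1,2)] sub[OF BC(3,4)] by (auto simp: disjnt_def)
      qed
    qed
  qed
  assume B: "B \<in> \<B>" and v: "v \<in> B"
  have E2: "E \<inter> [B]\<^bsup>2\<^esup> \<subseteq> [B]\<^bsup>2\<^esup>" by simp
  show "swap_along (\<Union>B\<in>\<B>. N B) v = swap_along (N B) v"
  proof (rule swap_along_cases[OF N[OF B] E2, of v])
    assume "{v, swap_along (N B) v} \<in> N B"
    then show ?thesis using gm B by (intro swap_along_eq) (auto simp: graph_matching_def)
  next
    assume *: "swap_along (N B) v = v" "v \<notin> \<Union>(N B)"
    have "v \<notin> \<Union>(\<Union>B\<in>\<B>. N B)"
    proof
      assume "v \<in> \<Union>(\<Union>B\<in>\<B>. N B)"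
      then obtain C e where C: "C \<in> \<B>" "e \<in> N C" "v \<in> e" by auto
      then have "v \<in> C" using sub by blast
      then have "C = B" using dis v B C(1) by (auto simp: pairwise_def disjnt_def)
      then show False using * C by auto
    qed
    then show ?thesis using * swap_along_notin by metis
  qed
qed

text \<open>In the merged strategy each agent follows exactly the trajectory of its own block.
  Therefore \<open>cross\<close> can be phrased with the block trajectories, which depend only on
  edges inside blocks.\<close>

lemma merge_block_strategies:
  fixes E :: "'a set set" and st :: "'a set \<Rightarrow> 'a set set list"
  assumes dis: "pairwise disjnt \<B>" and V: "\<Union>\<B> = V"
    and len: "\<And>B. B \<in> \<B> \<Longrightarrow> length (st B) = L"
    and st: "\<And>B. B \<in> \<B> \<Longrightarrow> acquaintance_strategy B (E \<inter> [B]\<^bsup>2\<^esup>) (st B)"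
    and cross: "\<And>B C a b. B \<in> \<B> \<Longrightarrow> C \<in> \<B> \<Longrightarrow> B \<noteq> C \<Longrightarrow> a \<in> B \<Longrightarrow> b \<in> C \<Longrightarrow>
       \<exists>t\<le>L. {agent_position (st B) t a, agent_position (st C) t b} \<in> E"
  shows "\<exists>Ms. length Ms = L \<and> acquaintance_strategy V E Ms"
proof -
  define M where "M = (\<lambda>t. \<Union>B\<in>\<B>. st B ! t)"
  define Ms where "Ms = map M [0..<L]"
  have gmB: "graph_matching (E \<inter> [B]\<^bsup>2\<^esup>) (st B ! t)" if "B \<in> \<B>" "t < L" for B t
    using st[OF that(1)] len[OF that(1)] that(2) by (auto simp: acquaintance_strategy_def)
  have gm: "graph_matching E (M t)" if "t < L" for t
    unfolding M_def by (rule swap_along_Union_blocks(1)[OF gmB dis]) (use that in auto)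
  have pos: "agent_position Ms t a = agent_position (st B) t a \<and> agent_position (st B) t a \<in> B"
    if B: "B \<in> \<B>" and a: "a \<in> B" and t: "t \<le> L" for B a t
    using t
  proof (induction t)
    case 0
    then show ?case using a by (simp add: agent_position_def)
  next
    case (Suc t)
    then have tL: "t < L" by simp
    let ?w = "agent_position (st B) t a"
    have w: "agent_position Ms t a = ?w" "?w \<in> B" using Suc by auto
    have "agent_position Ms (Suc t) a = swap_along (M t) ?w"
      using w tL by (subst agent_position_Suc) (auto simp: Ms_def)
    also have "\<dots> = swap_along (st B ! t) ?w"
      unfolding M_def by (rule swap_along_Union_blocks(2)[OF gmB dis B w(2)]) (use tL in auto)
    also have "\<dots> = agent_position (st B) (Suc t) a"
      using len[OF B] tL by (subst agent_position_Suc) auto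
    finally have "agent_position Ms (Suc t) a = agent_position (st B) (Suc t) a" .
    moreover have "agent_position (st B) (Suc t) a \<in> B"
      using st[OF B] a by (intro agent_position_in[of _ "E \<inter> [B]\<^bsup>2\<^esup>"]) (auto simp: acquaintance_strategy_def)
    ultimately show ?case by simp
  qed
  have "acquainted E Ms a b" if ab: "a \<in> V" "b \<in> V" "a \<noteq> b" for a b
  proof -
    obtain B C where BC: "B \<in> \<B>" "C \<in> \<B>" "a \<in> B" "b \<in> C" using ab V by auto
    have "\<exists>t\<le>L. {agent_position (st B) t a, agent_position (st C) t b} \<in> E"
    proof (cases "B = C")
      case True
      then have "acquainted (E \<inter> [B]\<^bsup>2\<^esup>) (st B) a b"
        using st[OF BC(1)] BC ab(3) by (simp add: acquaintance_strategy_def)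
      then show ?thesis using True len[OF BC(1)] by (auto simp: acquainted_def)
    next
      case False
      then show ?thesis using cross BC by metis
    qed
    then show ?thesis using pos[OF BC(1,3)] pos[OF BC(2,4)] by (auto simp: acquainted_def Ms_def)
  qed
  then show ?thesis using gm
    by (intro exI[of _ Ms]) (auto simp: acquaintance_strategy_def Ms_def)
qed

text \<open>With a quarter as the size of the joined sets, depth-first search leaves a path on more
  than half of the block.\<close>

definition good_block :: "'a set \<Rightarrow> 'a set set \<Rightarrow> bool" where
  "good_block B H \<longleftrightarrow> connected_graph B H \<and>
     (\<forall>X Y. X \<subseteq> B \<longrightarrow> Y \<subseteq> B \<longrightarrow> X \<inter> Y = {} \<longrightarrow> card X = card B div 4 \<longrightarrow> card Y = card B div 4 \<longrightarrow>
        (\<exists>x\<in>X. \<exists>y\<in>Y. {x, y} \<in> H))"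

lemma good_block_strategy:
  fixes H :: "'a set set"
  assumes fin: "finite B" and B: "card B \<ge> 16" and H: "H \<subseteq> [B]\<^bsup>2\<^esup>" and good: "good_block B H"
    and L: "4000 * card B \<le> L"
  shows "\<exists>Ms. length Ms = L \<and> acquaintance_strategy B H Ms \<and>
    (\<forall>a\<in>B. card B \<le> 2 * card (visited Ms a))"
proof -
  obtain x m where path: "path_in B H x m" and m: "card B + 2 \<le> m + 2 * (card B div 4)"
    using expander_has_long_path[OF fin H, of "card B div 4"] good unfolding good_block_def by metis
  have m2: "card B \<le> 2 * m" using m by presburger
  have con: "connected_graph B H" using good by (simp add: good_block_def)
  obtain Ms where Ms: "length Ms \<le> 4000 * card B" "acquaintance_strategy B H Ms"
    "\<forall>a\<in>B. x ` {..<m} \<subseteq> visited Ms a"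
    using acquaintance_via_long_path[OF fin H con path] m2 B by auto
  \<comment> \<open>Empty rounds bring all blocks to the common length \<open>L\<close> that merging
    requires.\<close>
  define Ns where "Ns = Ms @ replicate (L - length Ms) {}"
  have "length Ns = L" using Ms(1) L by (simp add: Ns_def)
  moreover have "acquaintance_strategy B H Ns"
    using Ms(2) unfolding acquaintance_strategy_def Ns_def
    by (auto intro: acquainted_append_right simp: graph_matching_def)
  moreover have "card B \<le> 2 * card (visited Ns a)" if "a \<in> B" for a
  proof -
    have "x ` {..<m} \<subseteq> visited Ns a"
      using Ms(3) that visited_append_right[of Ms a "replicate (L - length Ms) {}"] by (auto simp: Ns_def)
    then have "card (x ` {..<m}) \<le> card (visited Ns a)"
      by (rule card_mono[rotated]) (simp add: visited_def)
    then show ?thesis using path m2 by (simp add: path_in_def card_image)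
  qed
  ultimately show ?thesis by blast
qed

section \<open>Probability estimates\<close>

abbreviation bern :: "'a set \<Rightarrow> real \<Rightarrow> ('a \<Rightarrow> bool) pmf" where
  "bern A p \<equiv> Pi_pmf A False (\<lambda>_. bernoulli_pmf p)"

lemma prob_all_absent:
  assumes "finite A" "X \<subseteq> A" "p \<in> {0..1}"
  shows "measure_pmf.prob (bern A p) {\<omega>. \<forall>e\<in>X. \<not> \<omega> e} = (1 - p) ^ card X"
proof -
  have "{\<omega>. \<forall>e\<in>X. \<not> \<omega> e} = Pi A (\<lambda>e. if e \<in> X then {False} else UNIV)"
    using assms(2) by (auto simp: Pi_def)
  then have "measure_pmf.prob (bern A p) {\<omega>. \<forall>e\<in>X. \<not> \<omega> e} =
      (\<Prod>e\<in>A. measure_pmf.prob (bernoulli_pmf p) (if e \<in> X then {False} else UNIV))"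
    by (simp only: measure_Pi_pmf_Pi[OF assms(1)])
  also have "\<dots> = (\<Prod>e\<in>A. if e \<in> X then 1 - p else 1)"
    using assms(3) by (intro prod.cong) (auto simp: measure_pmf_single)
  also have "\<dots> = (\<Prod>e\<in>A \<inter> X. 1 - p)"
    by (rule prod.inter_restrict[OF assms(1), symmetric])
  also have "A \<inter> X = X" using assms(2) by blast
  finally show ?thesis by simp
qed

lemma prob_all_absent_le:
  assumes "finite A" "X \<subseteq> A" "p \<in> {0..1}" "d \<le> real (card X)"
  shows "measure_pmf.prob (bern A p) {\<omega>. \<forall>e\<in>X. \<not> \<omega> e} \<le> exp (- p * d)"
proof -
  have "measure_pmf.prob (bern A p) {\<omega>. \<forall>e\<in>X. \<not> \<omega> e} = (1 - p) ^ card X"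
    by (rule prob_all_absent[OF assms(1-3)])
  also have "\<dots> \<le> exp (- p) ^ card X"
    using assms(3) exp_ge_add_one_self[of "- p"] by (intro power_mono) auto
  also have "\<dots> = exp (- p * card X)"
    by (metis exp_of_nat2_mult)
  also have "\<dots> \<le> exp (- p * d)" using assms(3,4) by (simp add: mult_left_mono)
  finally show ?thesis .
qed

lemma prob_UN_le_sum:
  assumes "finite I" "\<And>i. i \<in> I \<Longrightarrow> measure_pmf.prob M (F i) \<le> f i"
  shows "measure_pmf.prob M (\<Union>i\<in>I. F i) \<le> sum f I"
proof -
  have "measure_pmf.prob M (\<Union>i\<in>I. F i) \<le> (\<Sum>i\<in>I. measure_pmf.prob M (F i))"
    by (rule measure_pmf.finite_measure_subadditive_finite[OF assms(1)]) simp
  also have "\<dots> \<le> sum f I" using assms(2) by (rule sum_mono)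
  finally show ?thesis .
qed

definition cross_pairs :: "'a set \<Rightarrow> 'a set \<Rightarrow> 'a set set" where
  "cross_pairs X Y = (\<lambda>(x, y). {x, y}) ` (X \<times> Y)"

lemma card_cross_pairs:
  assumes "X \<inter> Y = {}"
  shows "card (cross_pairs X Y) = card X * card Y"
proof -
  have "inj_on (\<lambda>(x, y). {x, y}) (X \<times> Y)"
    using assms by (auto simp: inj_on_def doubleton_eq_iff)
  then show ?thesis unfolding cross_pairs_def by (simp add: card_image card_cartesian_product)
qed

lemma cross_pairs_subset:
  assumes "X \<inter> Y = {}" "X \<subseteq> B" "Y \<subseteq> B"
  shows "cross_pairs X Y \<subseteq> [B]\<^bsup>2\<^esup>"
proof
  fix e assume "e \<in> cross_pairs X Y"
  then obtain x y where e: "e = {x, y}" "x \<in> X" "y \<in> Y" by (auto simp: cross_pairs_def)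
  then have "x \<noteq> y" using assms(1) by auto
  then show "e \<in> [B]\<^bsup>2\<^esup>" using e assms(2,3) by (simp add: pair_in_nsets2 subset_iff)
qed

section \<open>Failure probability of a single block\<close>

lemma power_self_le_fact_exp: "real s ^ s \<le> fact s * exp (real s)"
proof -
  have "(\<lambda>n. real s ^ n /\<^sub>R fact n) sums exp (real s)" by (rule exp_converges)
  then have "(\<Sum>n\<in>{s}. real s ^ n /\<^sub>R fact n) \<le> exp (real s)"
    using sum_le_suminf[of "\<lambda>n. real s ^ n /\<^sub>R fact n" "{s}"] by (simp add: sums_iff)
  then show ?thesis by (simp add: field_simps)
qed

text \<open>This is the bound \<open>(e * b / s) ^ s\<close>, written as an exponential so that it
  combines with the probability of an empty cut. It follows from
  \<open>s ^ s \<le> s! * e ^ s\<close>.\<close>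

lemma binomial_le_exp:
  assumes "s > 0" "b > 0"
  shows "real (b choose s) \<le> exp (real s * (1 + ln (real b) - ln (real s)))"
proof -
  have "real (b choose s) * fact s \<le> real b ^ s"
    using binomial_fact_pow[of b s] by (metis of_nat_fact of_nat_le_iff of_nat_mult of_nat_power)
  then have "real (b choose s) * fact s * exp (real s) \<le> real b ^ s * exp (real s)"
    by (intro mult_right_mono) auto
  moreover have "real (b choose s) * real s ^ s \<le> real (b choose s) * (fact s * exp (real s))"
    using power_self_le_fact_exp by (intro mult_left_mono) auto
  ultimately have "real (b choose s) * real s ^ s \<le> real b ^ s * exp (real s)" by linarith
  then have "real (b choose s) \<le> real b ^ s * exp (real s) / real s ^ s"
    using assms by (simp add: field_simps)
  also have "\<dots> = exp (real s * ln b) * exp (real s) / exp (real s * ln s)"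
    using assms by (simp add: exp_of_nat_mult)
  also have "\<dots> = exp (real s * (1 + ln (real b) - ln (real s)))"
    by (simp add: algebra_simps flip: exp_add exp_diff)
  finally show ?thesis .
qed

lemma ln_le_self_div_2: "ln y \<le> y / 2" if "y > 0" for y :: real
proof -
  have "ln (2::real) \<le> 1" using ln_le_minus_one[of "2::real"] by simp
  moreover have "ln (y / 2) \<le> y / 2 - 1" using ln_le_minus_one[of "y / 2"] that by simp
  moreover have "ln (y / 2) = ln y - ln 2" using that by (simp add: ln_div)
  ultimately show ?thesis by linarith
qed

text \<open>A weak form of concavity: \<open>ln s\<close> lies above the chord of \<open>ln\<close>
  from \<open>1\<close> to \<open>b\<close>. It controls the loss from \<open>b - s\<close> in place
  of \<open>b\<close> in the size of a cut.\<close>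

lemma ln_ge_chord:
  fixes s b :: real
  assumes "1 \<le> s" "2 * s \<le> b"
  shows "(s - 1) * ln b \<le> b * ln s"
proof (cases "s\<^sup>2 \<ge> b")
  case True
  have "ln b \<le> ln (s\<^sup>2)" using assms True by (subst ln_le_cancel_iff) auto
  then have "ln b \<le> 2 * ln s" using assms by (simp add: ln_realpow)
  then have "(s - 1) * ln b \<le> (s - 1) * (2 * ln s)" using assms by (intro mult_left_mono) auto
  also have "\<dots> = (2 * (s - 1)) * ln s" by simp
  also have "\<dots> \<le> b * ln s" using assms by (intro mult_right_mono) auto
  finally show ?thesis .
next
  case False
  \<comment> \<open>Here \<open>s\<close> and \<open>ln b\<close> are both at most
    \<open>sqrt b\<close>, so \<open>s * ln b \<le> b\<close>.\<close>
  define r where "r = sqrt b"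
  have r: "r > 0" "r * r = b" using assms by (auto simp: r_def)
  have "s \<le> r" using False assms unfolding r_def by (intro real_le_rsqrt) auto
  have "ln b = 2 * ln r" using r by (metis ln_mult mult_2 less_irrefl)
  then have "ln b \<le> r" using ln_le_self_div_2[OF r(1)] by linarith
  then have "s * ln b \<le> r * r" using \<open>s \<le> r\<close> assms r by (intro mult_mono) auto
  then have 1: "ln b \<le> b / s" using assms r by (simp add: field_simps)
  have "ln (1 / s) \<le> 1 / s - 1" using assms by (intro ln_le_minus_one) auto
  then have "1 - 1 / s \<le> ln s" using assms by (simp add: ln_div)
  then have 2: "(s - 1) / s \<le> ln s" using assms by (simp add: field_simps)
  have "(s - 1) * ln b \<le> (s - 1) * (b / s)" using 1 assms by (intro mult_left_mono) auto
  also have "\<dots> = b * ((s - 1) / s)" by simp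
  also have "\<dots> \<le> b * ln s" using 2 assms by (intro mult_left_mono) auto
  finally show ?thesis .
qed

text \<open>\<open>w\<close> measures the excess over the connectivity threshold. After division by
  \<open>s\<close> the exponent is \<open>1 - ln s - w + p * s\<close>. The chord inequality
  together with \<open>s - 1 \<le> b / 2\<close> gives
  \<open>(s - 1) * p \<le> ln s + w / 2\<close>, and \<open>p \<le> 1\<close> accounts for the
  rest.\<close>

lemma cut_term_bound:
  fixes p w :: real
  assumes s: "1 \<le> s" "2 * s \<le> b" and p: "p \<in> {0..1}" and w: "w = p * real b - ln (real b)" "w \<ge> 0"
  shows "real (b choose s) * exp (- p * real (s * (b - s))) \<le> exp (2 - w / 2) ^ s"
proof -
  have b: "real b > 0" "real s \<ge> 1" "2 * real s \<le> real b" using s by auto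
  have pb: "p * b = ln b + w" using w by simp
  have "(real s - 1) * (p * b) = (real s - 1) * ln b + (real s - 1) * w"
    unfolding pb by (rule distrib_left)
  also have "\<dots> \<le> b * ln s + b / 2 * w"
    using ln_ge_chord[OF b(2,3)] b w(2) by (intro add_mono mult_right_mono) auto
  finally have "b * ((real s - 1) * p) \<le> b * (ln s + w / 2)" by (simp add: algebra_simps)
  then have key: "(real s - 1) * p \<le> ln s + w / 2" using b by simp
  have "p \<le> 1" using p by simp
  then have "1 + ln b - ln s - p * (real b - real s) \<le> 2 - w / 2"
  proof -
    have "p * (real b - real s) = ln b + w - p * s" by (simp add: right_diff_distrib pb)
    moreover have "(real s - 1) * p = p * s - p" by (simp add: algebra_simps)
    ultimately show ?thesis using key \<open>p \<le> 1\<close> by linarith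
  qed
  then have *: "real s * (1 + ln b - ln s - p * (real b - real s)) \<le> real s * (2 - w / 2)"
    by (intro mult_left_mono) auto
  have "real (b choose s) * exp (- p * real (s * (b - s)))
      \<le> exp (real s * (1 + ln (real b) - ln (real s))) * exp (- p * real (s * (b - s)))"
    using s by (intro mult_right_mono binomial_le_exp) auto
  also have "\<dots> = exp (real s * (1 + ln b - ln s - p * (real b - real s)))"
    using s by (simp add: of_nat_diff algebra_simps flip: exp_add)
  also have "\<dots> \<le> exp (real s * (2 - w / 2))" using * by simp
  also have "\<dots> = exp (2 - w / 2) ^ s" by (simp add: exp_of_nat_mult)
  finally show ?thesis .
qed

text \<open>The subtracted term carries the induction; the consequence used is the bound
  \<open>2 * r\<close>.\<close>

lemma geometric_tail_le:
  fixes r :: real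
  assumes "0 \<le> r" "r \<le> 1 / 2"
  shows "(\<Sum>s=1..k. r ^ s) \<le> 2 * r - 2 * r * r ^ k"
proof (induction k)
  case 0
  then show ?case using assms by simp
next
  case (Suc k)
  have "r ^ Suc k * (2 * r) \<le> r ^ Suc k * 1" using assms by (intro mult_left_mono) auto
  then have "r ^ Suc k + 2 * r * r ^ Suc k \<le> 2 * r * r ^ k" by (simp add: ac_simps)
  moreover have "(\<Sum>s=1..Suc k. r ^ s) = (\<Sum>s=1..k. r ^ s) + r ^ Suc k" by simp
  ultimately show ?case using Suc.IH by linarith
qed

text \<open>A disconnected block has an empty cut with a smaller side of size
  \<open>s \<le> b div 2\<close>. The union bound over these sides is dominated by a geometric
  series with ratio \<open>r\<close>.\<close>

lemma prob_disconnected: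
  fixes p :: real
  assumes fin: "finite A" and sub: "[B]\<^bsup>2\<^esup> \<subseteq> A" and B: "finite B" "B \<noteq> {}" and p: "p \<in> {0..1}"
  shows "measure_pmf.prob (bern A p) {\<omega>. \<not> connected_graph B {e \<in> [B]\<^bsup>2\<^esup>. \<omega> e}}
    \<le> 2 * exp (2 - (p * card B - ln (card B)) / 2)"
proof -
  define b where "b = card B"
  define w where "w = p * real b - ln (real b)"
  define r where "r = exp (2 - w / 2)"
  define S where "S = (\<lambda>s. {T. T \<subseteq> B \<and> card T = s})"
  define F where "F = (\<lambda>T. {\<omega>. \<forall>e\<in>cross_pairs T (B - T). \<not> \<omega> e})"
  have finS: "finite (S s)" for s using B by (simp add: S_def)
  show ?thesis
  proof (cases "r \<le> 1 / 2")
    \<comment> \<open>The asserted bound is at least \<open>1\<close> in this case.\<close>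
    case False
    have "measure_pmf.prob (bern A p) {\<omega>. \<not> connected_graph B {e \<in> [B]\<^bsup>2\<^esup>. \<omega> e}} \<le> 1"
      by (rule measure_pmf.prob_le_1)
    also have "1 \<le> 2 * r" using False by simp
    finally show ?thesis by (simp add: r_def w_def b_def)
  next
    case True
    have "r \<le> 1" using True by simp
    then have "2 - w / 2 \<le> 0" unfolding r_def by (simp only: exp_le_one_iff)
    then have w0: "w \<ge> 0" by linarith
    have sub1: "{\<omega>. \<not> connected_graph B {e \<in> [B]\<^bsup>2\<^esup>. \<omega> e}} \<subseteq> (\<Union>s\<in>{1..b div 2}. \<Union>T\<in>S s. F T)"
    proof
      fix \<omega> assume "\<omega> \<in> {\<omega>. \<not> connected_graph B {e \<in> [B]\<^bsup>2\<^esup>. \<omega> e}}"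
      then obtain T where T: "T \<subseteq> B" "T \<noteq> {}" "2 * card T \<le> card B"
        "\<forall>u\<in>T. \<forall>v\<in>B - T. {u, v} \<notin> {e \<in> [B]\<^bsup>2\<^esup>. \<omega> e}"
        using disconnected_cut[OF B, of "{e \<in> [B]\<^bsup>2\<^esup>. \<omega> e}"] by auto
      have "card T \<ge> 1" using T B by (simp add: Suc_le_eq card_gt_0_iff finite_subset)
      moreover have "\<not> \<omega> {u, v}" if "u \<in> T" "v \<in> B - T" for u v
      proof -
        have "{u, v} \<in> [B]\<^bsup>2\<^esup>" using that T(1) by (auto simp: pair_in_nsets2)
        then show ?thesis using T(4) that by blast
      qed
      ultimately show "\<omega> \<in> (\<Union>s\<in>{1..b div 2}. \<Union>T\<in>S s. F T)"
        using T by (intro UN_I[of "card T"] UN_I[of T]) (auto simp: S_def F_def cross_pairs_def b_def)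
    qed
    have FT: "measure_pmf.prob (bern A p) (F T) \<le> exp (- p * real (s * (b - s)))"
      if "T \<in> S s" for T s
    proof -
      have T: "T \<subseteq> B" "card T = s" using that by (auto simp: S_def)
      have "card (cross_pairs T (B - T)) = s * (b - s)"
        using T B by (subst card_cross_pairs) (auto simp: card_Diff_subset finite_subset b_def)
      moreover have "cross_pairs T (B - T) \<subseteq> A"
        using cross_pairs_subset[of T "B - T" B] T(1) sub by auto
      ultimately show ?thesis unfolding F_def using fin p by (intro prob_all_absent_le) auto
    qed
    have "measure_pmf.prob (bern A p) {\<omega>. \<not> connected_graph B {e \<in> [B]\<^bsup>2\<^esup>. \<omega> e}}
      \<le> measure_pmf.prob (bern A p) (\<Union>s\<in>{1..b div 2}. \<Union>T\<in>S s. F T)"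
      using sub1 by (intro measure_pmf.finite_measure_mono) auto
    also have "\<dots> \<le> (\<Sum>s\<in>{1..b div 2}. r ^ s)"
    proof (rule prob_UN_le_sum)
      fix s assume s: "s \<in> {1..b div 2}"
      have "measure_pmf.prob (bern A p) (\<Union>T\<in>S s. F T) \<le> (\<Sum>T\<in>S s. exp (- p * real (s * (b - s))))"
        by (rule prob_UN_le_sum[OF finS FT])
      also have "\<dots> = real (b choose s) * exp (- p * real (s * (b - s)))"
        using B n_subsets[of B s] by (simp add: S_def b_def)
      also have "\<dots> \<le> r ^ s"
        unfolding r_def using s p w0 by (intro cut_term_bound) (auto simp: w_def)
      finally show "measure_pmf.prob (bern A p) (\<Union>T\<in>S s. F T) \<le> r ^ s" .
    qed simp
    also have "\<dots> \<le> 2 * r - 2 * r * r ^ (b div 2)" using True by (intro geometric_tail_le) (auto simp: r_def)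
    also have "\<dots> \<le> 2 * r" by (simp add: r_def)
    finally show ?thesis by (simp add: r_def w_def b_def)
  qed
qed

text \<open>The constant \<open>exp 35\<close> makes the bound trivial when \<open>p * card B < 70\<close>.\<close>

lemma prob_not_joined:
  fixes p :: real and B :: "'a set"
  assumes fin: "finite A" and sub: "[B]\<^bsup>2\<^esup> \<subseteq> A" and B: "finite B" "card B \<ge> 25" and p: "p \<in> {0..1}"
  shows "measure_pmf.prob (bern A p) {\<omega>. \<exists>X Y. X \<subseteq> B \<and> Y \<subseteq> B \<and> X \<inter> Y = {} \<and>
       card X = card B div 4 \<and> card Y = card B div 4 \<and> (\<forall>x\<in>X. \<forall>y\<in>Y. \<not> \<omega> {x, y})}
    \<le> exp 35 * exp (- (p * card B - ln (card B)) / 2)" (is "measure_pmf.prob _ ?bad \<le> _")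
proof -
  define b where "b = card B"
  have b25: "real b \<ge> 25" using B by (simp add: b_def)
  have lnb: "ln (real b) \<ge> 0" using b25 by simp
  show ?thesis
  proof (cases "p * b \<ge> 70")
    case False
    have "0 \<le> 35 + - (z - l) / 2" if "\<not> 70 \<le> z" "0 \<le> l" for z l :: real
      using that by (simp add: field_simps)
    from this[OF False lnb] have "1 \<le> exp (35 + - (p * real b - ln (real b)) / 2)"
      by (simp only: one_le_exp_iff)
    with measure_pmf.prob_le_1 have "measure_pmf.prob (bern A p) ?bad \<le> exp (35 + - (p * real b - ln (real b)) / 2)"
      by (rule order_trans)
    then show ?thesis unfolding exp_add b_def .
  next
    case True
    define k where "k = b div 4"
    define Z where "Z = {(X, Y). X \<subseteq> B \<and> Y \<subseteq> B \<and> X \<inter> Y = {} \<and> card X = k \<and> card Y = k}"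
    define F where "F = (\<lambda>(X :: 'a set, Y). {\<omega>. \<forall>e\<in>cross_pairs X Y. \<not> \<omega> e})"
    have "b \<le> 5 * k" using B unfolding k_def b_def by presburger
    then have "real b / 5 \<le> real k" by linarith
    then have k2: "(real b / 5) * (real b / 5) \<le> real (k * k)" using b25 unfolding of_nat_mult by (intro mult_mono) auto
    have ZP: "Z \<subseteq> Pow B \<times> Pow B" by (auto simp: Z_def)
    have finZ: "finite Z" using ZP B finite_subset by blast
    \<comment> \<open>At most \<open>4 ^ b\<close> pairs of sets compete, and
      \<open>2 * ln 2 \<le> 7 / 5\<close>.\<close>
    have "card Z \<le> card (Pow B \<times> Pow B)" using ZP B by (intro card_mono) auto
    also have "\<dots> = 2 ^ b * 2 ^ b" using B by (simp add: card_cartesian_product card_Pow b_def)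
    finally have "real (card Z) \<le> real (2 ^ b * 2 ^ b)" by (simp only: of_nat_le_iff)
    also have "\<dots> = 2 ^ b * 2 ^ b" by simp
    also have "\<dots> = exp (b * ln 2) * exp (b * ln 2)" by (simp add: exp_of_nat_mult)
    also have "\<dots> = exp (2 * b * ln 2)" by (simp flip: exp_add)
    also have "\<dots> \<le> exp (2 * b * (7/10))"
    proof -
      have "2 * real b * ln 2 \<le> 2 * real b * (7/10)"
        using ln2_le_25_over_36 by (intro mult_left_mono) auto
      then show ?thesis by (simp only: exp_le_cancel_iff)
    qed
    finally have cZ: "real (card Z) \<le> exp (2 * b * (7/10))" .
    have "measure_pmf.prob (bern A p) ?bad \<le> measure_pmf.prob (bern A p) (\<Union>z\<in>Z. F z)"
      by (intro measure_pmf.finite_measure_mono)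
        (auto simp: Z_def F_def k_def b_def cross_pairs_def)
    also have "\<dots> \<le> (\<Sum>z\<in>Z. exp (- p * (real b / 5 * (real b / 5))))"
    proof (rule prob_UN_le_sum[OF finZ])
      fix z assume "z \<in> Z"
      then obtain X Y where z: "z = (X, Y)" "X \<subseteq> B" "Y \<subseteq> B" "X \<inter> Y = {}" "card X = k" "card Y = k"
        by (auto simp: Z_def)
      have "cross_pairs X Y \<subseteq> A" using cross_pairs_subset[OF z(4,2,3)] sub by auto
      then show "measure_pmf.prob (bern A p) (F z) \<le> exp (- p * (real b / 5 * (real b / 5)))"
        unfolding z(1) F_def prod.case using k2 z card_cross_pairs[OF z(4)]
        by (intro prob_all_absent_le[OF fin _ p]) auto
    qed
    also have "\<dots> = real (card Z) * exp (- p * (real b / 5 * (real b / 5)))" by simp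
    also have "\<dots> \<le> exp (2 * b * (7/10)) * exp (- p * (real b / 5 * (real b / 5)))"
      using cZ by (intro mult_right_mono) auto
    also have "\<dots> = exp (b * (7/5 - p * b / 25))" by (simp add: algebra_simps flip: exp_add)
    \<comment> \<open>\<open>p * b \<ge> 70\<close> means \<open>7 / 5 \<le> p * b / 50\<close>, so
      half of the negative term absorbs the entropy. Then \<open>b \<ge> 25\<close> turns the other
      half into \<open>p * b / 2\<close>.\<close>
    also have "\<dots> \<le> exp (- (p * b) / 2)"
    proof -
      have "b * (7/5 - p * b / 25) \<le> b * (- (p * b) / 50)"
        using True by (intro mult_left_mono) auto
      also have "\<dots> = - (b * (p * b)) / 50" by simp
      also have "\<dots> \<le> - (p * b) / 2"
      proof -
        have "b * (p * b) \<ge> 25 * (p * b)" using b25 True by (intro mult_right_mono) auto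
        then show ?thesis by simp
      qed
      finally show ?thesis by simp
    qed
    also have "\<dots> \<le> exp (35 + - (p * real b - ln (real b)) / 2)"
    proof -
      have "- z / 2 \<le> 35 + - (z - l) / 2" if "0 \<le> l" for z l :: real
        using that by (simp add: field_simps)
      from this[OF lnb] show ?thesis by (simp only: exp_le_cancel_iff)
    qed
    finally show ?thesis unfolding exp_add b_def .
  qed
qed

lemma prob_bad_block:
  fixes p :: real
  assumes fin: "finite A" and sub: "[B]\<^bsup>2\<^esup> \<subseteq> A" and B: "finite B" "card B \<ge> 25" and p: "p \<in> {0..1}"
  shows "measure_pmf.prob (bern A p) {\<omega>. \<not> good_block B {e \<in> [B]\<^bsup>2\<^esup>. \<omega> e}}
    \<le> (2 * exp 2 + exp 35) * exp (- (p * card B - ln (card B)) / 2)"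
proof -
  let ?D = "{\<omega>. \<not> connected_graph B {e \<in> [B]\<^bsup>2\<^esup>. \<omega> e}}"
  let ?J = "{\<omega>. \<exists>X Y. X \<subseteq> B \<and> Y \<subseteq> B \<and> X \<inter> Y = {} \<and>
       card X = card B div 4 \<and> card Y = card B div 4 \<and> (\<forall>x\<in>X. \<forall>y\<in>Y. \<not> \<omega> {x, y})}"
  have "{\<omega>. \<not> good_block B {e \<in> [B]\<^bsup>2\<^esup>. \<omega> e}} \<subseteq> ?D \<union> ?J"
  proof
    fix \<omega> assume "\<omega> \<in> {\<omega>. \<not> good_block B {e \<in> [B]\<^bsup>2\<^esup>. \<omega> e}}"
    then have ng: "\<not> good_block B {e \<in> [B]\<^bsup>2\<^esup>. \<omega> e}" by simp
    show "\<omega> \<in> ?D \<union> ?J"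
    proof (cases "\<omega> \<in> ?D")
      case False
      then obtain X Y where XY: "X \<subseteq> B" "Y \<subseteq> B" "X \<inter> Y = {}" "card X = card B div 4" "card Y = card B div 4"
        "\<forall>x\<in>X. \<forall>y\<in>Y. {x, y} \<notin> {e \<in> [B]\<^bsup>2\<^esup>. \<omega> e}"
        using ng unfolding good_block_def by auto
      have "\<not> \<omega> {x, y}" if "x \<in> X" "y \<in> Y" for x y
      proof -
        have "{x, y} \<in> [B]\<^bsup>2\<^esup>" using that XY(1-3) by (auto simp: pair_in_nsets2)
        then show ?thesis using XY(6) that by blast
      qed
      then show ?thesis using XY(1-5) by blast
    qed simp
  qed
  then have "measure_pmf.prob (bern A p) {\<omega>. \<not> good_block B {e \<in> [B]\<^bsup>2\<^esup>. \<omega> e}}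
    \<le> measure_pmf.prob (bern A p) (?D \<union> ?J)"
    by (intro measure_pmf.finite_measure_mono) auto
  also have "\<dots> \<le> measure_pmf.prob (bern A p) ?D + measure_pmf.prob (bern A p) ?J"
    by (rule measure_Un_le) auto
  also have "\<dots> \<le> 2 * exp (2 - (p * card B - ln (card B)) / 2) +
      exp 35 * exp (- (p * card B - ln (card B)) / 2)"
    using B by (intro add_mono prob_disconnected[OF fin sub B(1) _ p] prob_not_joined[OF fin sub B p]) auto
  also have "\<dots> = (2 * exp 2 + exp 35) * exp (- (p * card B - ln (card B)) / 2)"
  proof -
    define w where "w = p * card B - ln (card B)"
    have "exp (2 - w / 2) = exp 2 * exp (- w / 2)" by (simp flip: exp_add)
    then show ?thesis unfolding w_def[symmetric] by (simp add: distrib_right)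
  qed
  finally show ?thesis .
qed

text \<open>A bound for every fixed first coordinate survives averaging. This is the conditioning on
  the edges inside the blocks.\<close>

lemma prob_pair_pmf_le:
  assumes "\<And>x. x \<in> set_pmf M \<Longrightarrow> measure_pmf.prob N {y. (x, y) \<in> F} \<le> \<epsilon>" "\<epsilon> \<ge> 0"
  shows "measure_pmf.prob (pair_pmf M N) F \<le> \<epsilon>"
proof -
  have "emeasure (pair_pmf M N) F = (\<integral>\<^sup>+x. indicator F x \<partial>pair_pmf M N)" by simp
  also have "\<dots> = (\<integral>\<^sup>+x. \<integral>\<^sup>+y. indicator F (x, y) \<partial>N \<partial>M)" by (rule nn_integral_pair_pmf')
  also have "\<dots> = (\<integral>\<^sup>+x. emeasure N {y. (x, y) \<in> F} \<partial>M)"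
  proof (rule nn_integral_cong)
    fix x
    have "(\<integral>\<^sup>+y. indicator F (x, y) \<partial>N) = (\<integral>\<^sup>+y. indicator {y. (x, y) \<in> F} y \<partial>N)"
      by (intro nn_integral_cong) (simp add: indicator_def)
    then show "(\<integral>\<^sup>+y. indicator F (x, y) \<partial>N) = emeasure N {y. (x, y) \<in> F}" by simp
  qed
  also have "\<dots> \<le> (\<integral>\<^sup>+x. ennreal \<epsilon> \<partial>M)"
    using assms by (intro nn_integral_mono_AE AE_pmfI)
      (simp add: measure_pmf.emeasure_eq_measure ennreal_leI)
  also have "\<dots> = ennreal \<epsilon>" by (simp add: measure_pmf.emeasure_space_1)
  finally show ?thesis using assms(2) by (simp add: measure_pmf.emeasure_eq_measure)
qed

section \<open>Random graphs split into blocks\<close>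

text \<open>The edges inside the blocks are exposed first and determine all trajectories; the edges
  between blocks are independent of them. The sum bounds the event of a bad block, and
  \<open>\<delta>\<close> the event that two agents from different blocks meet only non-edges. A
  single block makes \<open>cross\<close> vacuous.\<close>

lemma prob_no_strategy:
  fixes V :: "'a set" and p \<delta> :: real and k L :: nat
  assumes fin: "finite V" and dis: "pairwise disjnt \<B>" and V: "\<Union>\<B> = V" and p: "p \<in> {0..1}"
    and size: "\<And>B. B \<in> \<B> \<Longrightarrow> 25 \<le> card B \<and> k \<le> card B \<and> 4000 * card B \<le> L"
    and \<delta>: "\<delta> \<ge> 0"
    and cross: "\<And>B C. B \<in> \<B> \<Longrightarrow> C \<in> \<B> \<Longrightarrow> B \<noteq> C \<Longrightarrow> (card V)\<^sup>2 * exp (- p * (k / 2)) \<le> \<delta>"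
  shows "measure_pmf.prob (bern ([V]\<^bsup>2\<^esup>) p)
      {\<omega>. \<not> (\<exists>Ms. length Ms = L \<and> acquaintance_strategy V {e \<in> [V]\<^bsup>2\<^esup>. \<omega> e} Ms)}
    \<le> (\<Sum>B\<in>\<B>. (2 * exp 2 + exp 35) * exp (- (p * card B - ln (card B)) / 2)) + \<delta>"
    (is "measure_pmf.prob ?M ?N \<le> ?S + \<delta>")
proof -
  have finA: "finite ([V]\<^bsup>2\<^esup>)" using fin by (simp add: finite_imp_finite_nsets)
  have BV: "B \<subseteq> V" "finite B" if "B \<in> \<B>" for B
    using that V fin by (auto intro: finite_subset)
  have "\<B> \<subseteq> Pow V" using BV by auto
  then have finB: "finite \<B>" using fin finite_subset by blast
  have BA: "[B]\<^bsup>2\<^esup> \<subseteq> [V]\<^bsup>2\<^esup>" if "B \<in> \<B>" for B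
    using BV(1)[OF that] by (rule nsets_mono)
  define I where "I = (\<Union>B\<in>\<B>. [B]\<^bsup>2\<^esup>)"
  define X where "X = [V]\<^bsup>2\<^esup> - I"
  have IX: "[V]\<^bsup>2\<^esup> = I \<union> X" "I \<inter> X = {}" using BA by (auto simp: I_def X_def)
  have finIX: "finite I" "finite X" using finA IX(1) by auto
  define good where "good = (\<lambda>f :: 'a set \<Rightarrow> bool. \<forall>B\<in>\<B>. good_block B {e \<in> [B]\<^bsup>2\<^esup>. f e})"
  \<comment> \<open>The choice uses only the edges inside \<open>B\<close>, so fixing
    \<open>f\<close> fixes every trajectory.\<close>
  define st where "st = (\<lambda>(f :: 'a set \<Rightarrow> bool) B. SOME Ms. length Ms = L \<and>
     acquaintance_strategy B {e \<in> [B]\<^bsup>2\<^esup>. f e} Ms \<and> (\<forall>a\<in>B. card B \<le> 2 * card (visited Ms a)))"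
  have st: "length (st f B) = L \<and> acquaintance_strategy B {e \<in> [B]\<^bsup>2\<^esup>. f e} (st f B) \<and>
      (\<forall>a\<in>B. card B \<le> 2 * card (visited (st f B) a))" if "good f" "B \<in> \<B>" for f B
    unfolding st_def
  proof (rule someI_ex, rule good_block_strategy)
    show "good_block B {e \<in> [B]\<^bsup>2\<^esup>. f e}" using that by (simp add: good_def)
  qed (use size[OF that(2)] BV[OF that(2)] in auto)
  define blk where "blk = (\<lambda>a. SOME B. B \<in> \<B> \<and> a \<in> B)"
  have blk: "blk a \<in> \<B> \<and> a \<in> blk a" if "a \<in> V" for a
    unfolding blk_def by (rule someI_ex) (use that V in auto)
  have blk_eq: "blk a = B" if "a \<in> B" "B \<in> \<B>" for a B
  proof (rule ccontr)
    assume "blk a \<noteq> B"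
    moreover have "blk a \<in> \<B>" "a \<in> blk a" using blk[of a] that BV(1) by auto
    ultimately have "disjnt (blk a) B" using dis that(2) by (simp add: pairwise_def)
    then show False using that \<open>a \<in> blk a\<close> by (auto simp: disjnt_def)
  qed
  define Q where "Q = (\<lambda>f (a, b).
    (\<lambda>t. {agent_position (st f (blk a)) t a, agent_position (st f (blk b)) t b}) ` {..L})"
  define Z where "Z = {(a, b) \<in> V \<times> V. blk a \<noteq> blk b}"
  have inB: "agent_position (st f (blk a)) t a \<in> blk a" if "good f" "a \<in> V" for f a t
    using st[OF that(1), of "blk a"] blk[OF that(2)]
    by (intro agent_position_in[of _ "{e \<in> [blk a]\<^bsup>2\<^esup>. f e}"]) (auto simp: acquaintance_strategy_def)
  have split: "blk x \<noteq> blk y \<Longrightarrow> x \<in> V \<Longrightarrow> y \<in> V \<Longrightarrow> {x, y} \<in> X" for x y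
  proof -
    assume xy: "blk x \<noteq> blk y" "x \<in> V" "y \<in> V"
    have "{x, y} \<notin> [B]\<^bsup>2\<^esup>" if "B \<in> \<B>" for B
      using xy blk_eq[OF _ that] by (auto simp: pair_in_nsets2)
    moreover have "{x, y} \<in> [V]\<^bsup>2\<^esup>" using xy by (auto simp: pair_in_nsets2)
    ultimately show "{x, y} \<in> X" unfolding X_def I_def Diff_iff UN_iff by metis
  qed
  have QX: "Q f z \<subseteq> X" "real k / 2 \<le> card (Q f z)" if good: "good f" and z: "z \<in> Z" for f z
  proof -
    obtain a b where ab: "z = (a, b)" "a \<in> V" "b \<in> V" "blk a \<noteq> blk b" using z by (auto simp: Z_def)
    let ?x = "\<lambda>t. agent_position (st f (blk a)) t a"
    let ?y = "\<lambda>t. agent_position (st f (blk b)) t b"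
    note blka = blk[OF ab(2)] and blkb = blk[OF ab(3)]
    have xy: "?x t \<in> blk a" "?y t \<in> blk b" "?x t \<in> V" "?y t \<in> V" for t
      using inB[OF good ab(2)] inB[OF good ab(3)] blka blkb BV(1) by auto
    have bx: "blk (?x t) = blk a" "blk (?y t) = blk b" for t
      using blk_eq[OF xy(1)] blk_eq[OF xy(2)] blka blkb by blast+
    show "Q f z \<subseteq> X" unfolding ab(1) Q_def prod.case
    proof
      fix e assume "e \<in> (\<lambda>t. {?x t, ?y t}) ` {..L}"
      then obtain t where "e = {?x t, ?y t}" by auto
      then show "e \<in> X" using split[of "?x t" "?y t"] bx[of t] xy[of t] ab(4) by simp
    qed
    \<comment> \<open>Intersecting a pair with the block of \<open>a\<close> recovers the vertex of
      \<open>a\<close>. Hence there are at least as many distinct pairs as vertices visited by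
      \<open>a\<close>.\<close>
    have "visited (st f (blk a)) a \<subseteq> (\<lambda>e. the_elem (e \<inter> blk a)) ` Q f z"
    proof
      fix v assume "v \<in> visited (st f (blk a)) a"
      then obtain t where t: "t \<le> L" "v = ?x t"
        using st[OF good, of "blk a"] blka by (auto simp: visited_def)
      have "?y t \<notin> blk a" using bx(2)[of t] blk_eq[of "?y t" "blk a"] blka ab(4) by auto
      then have "{?x t, ?y t} \<inter> blk a = {?x t}" using xy(1)[of t] by auto
      then have "v = the_elem ({?x t, ?y t} \<inter> blk a)" using t by simp
      moreover have "{?x t, ?y t} \<in> Q f z" using t by (auto simp: Q_def ab(1))
      ultimately show "v \<in> (\<lambda>e. the_elem (e \<inter> blk a)) ` Q f z" by (rule image_eqI)
    qed
    moreover have finQ: "finite (Q f z)" by (simp add: Q_def ab(1))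
    ultimately have "card (visited (st f (blk a)) a) \<le> card (Q f z)"
      by (rule surj_card_le[rotated])
    moreover have "k \<le> 2 * card (visited (st f (blk a)) a)"
      using st[OF good, of "blk a"] blka size[of "blk a"] by (meson order_trans)
    ultimately show "real k / 2 \<le> card (Q f z)" by linarith
  qed
  \<comment> \<open>Gluing the independent configurations inside and between the blocks reproduces
    the law on all pairs.\<close>
  define h where "h = (\<lambda>(f, g) x. if x \<in> I then f x else g x :: bool)"
  have hB: "{e \<in> [B]\<^bsup>2\<^esup>. h (f, g) e} = {e \<in> [B]\<^bsup>2\<^esup>. f e}" if "B \<in> \<B>" for f g B
    using that by (auto simp: h_def I_def)
  have hgood: "good (h (f, g)) = good f" for f g
    unfolding good_def using hB by simp
  have fail: "\<exists>z\<in>Z. \<forall>e\<in>Q f z. \<not> g e" if good: "good f" and N: "h (f, g) \<in> ?N" for f g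
  proof (rule ccontr)
    assume neg: "\<not> ?thesis"
    let ?E = "{e \<in> [V]\<^bsup>2\<^esup>. h (f, g) e}"
    have EB: "?E \<inter> [B]\<^bsup>2\<^esup> = {e \<in> [B]\<^bsup>2\<^esup>. f e}" if "B \<in> \<B>" for B
      using hB[OF that, of f g] BA[OF that] by auto
    have "\<exists>Ms. length Ms = L \<and> acquaintance_strategy V ?E Ms"
    proof (rule merge_block_strategies[OF dis V, where st = "st f"])
      fix B assume B: "B \<in> \<B>"
      show "length (st f B) = L" using st[OF good B] by simp
      show "acquaintance_strategy B (?E \<inter> [B]\<^bsup>2\<^esup>) (st f B)" using st[OF good B] EB[OF B] by simp
    next
      fix B C a b assume BC: "B \<in> \<B>" "C \<in> \<B>" "B \<noteq> C" "a \<in> B" "b \<in> C"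
      have bb: "blk a = B" "blk b = C" using BC by (metis blk_eq)+
      have "a \<in> V" "b \<in> V" using BC BV(1) by (metis subsetD)+
      then have z: "(a, b) \<in> Z" using BC(3) bb by (simp add: Z_def)
      then obtain e where e: "e \<in> Q f (a, b)" "g e" using neg by auto
      then obtain t where t: "t \<le> L" "e = {agent_position (st f B) t a, agent_position (st f C) t b}"
        by (auto simp: Q_def bb)
      have "e \<in> X" using QX(1)[OF good z] e by auto
      then have "e \<in> ?E" using e IX by (auto simp: h_def)
      then show "\<exists>t\<le>L. {agent_position (st f B) t a, agent_position (st f C) t b} \<in> ?E"
        using t by metis
    qed
    then show False using CollectD[OF N] by metis
  qed
  have finZ: "finite Z" using finite_subset[of Z "V \<times> V"] fin by (auto simp: Z_def)
  \<comment> \<open>For fixed good \<open>f\<close> the pairs \<open>Q f z\<close> are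
    deterministic, so a union bound over \<open>Z\<close> applies. Goodness is decided by
    \<open>f\<close> alone, which empties the event for bad \<open>f\<close>.\<close>
  have inner: "measure_pmf.prob (bern X p) {g. (f, g) \<in> h -` {\<omega> \<in> ?N. good \<omega>}} \<le> \<delta>" for f
  proof (cases "good f")
    case False
    then have empty: "{g. (f, g) \<in> h -` {\<omega> \<in> ?N. good \<omega>}} = {}" using hgood by auto
    show ?thesis unfolding empty using \<delta> by simp
  next
    case True
    have "measure_pmf.prob (bern X p) {g. (f, g) \<in> h -` {\<omega> \<in> ?N. good \<omega>}}
       \<le> measure_pmf.prob (bern X p) (\<Union>z\<in>Z. {g. \<forall>e\<in>Q f z. \<not> g e})"
    proof (rule measure_pmf.finite_measure_mono)
      show "{g. (f, g) \<in> h -` {\<omega> \<in> ?N. good \<omega>}} \<subseteq> (\<Union>z\<in>Z. {g. \<forall>e\<in>Q f z. \<not> g e})"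
      proof
        fix g assume "g \<in> {g. (f, g) \<in> h -` {\<omega> \<in> ?N. good \<omega>}}"
        then have "h (f, g) \<in> ?N" unfolding mem_Collect_eq vimage_eq by (rule conjunct1)
        from fail[OF True this] show "g \<in> (\<Union>z\<in>Z. {g. \<forall>e\<in>Q f z. \<not> g e})" by simp
      qed
    qed simp
    also have "\<dots> \<le> (\<Sum>z\<in>Z. exp (- p * (real k / 2)))"
      by (rule prob_UN_le_sum[OF finZ], rule prob_all_absent_le[OF finIX(2) _ p]) (use QX[OF True] in auto)
    also have "\<dots> = card Z * exp (- p * (real k / 2))" by simp
    also have "\<dots> \<le> \<delta>"
    proof (cases "Z = {}")
      case False
      then obtain a b where "a \<in> V" "b \<in> V" "blk a \<noteq> blk b" by (auto simp: Z_def)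
      then have \<delta>': "(card V)\<^sup>2 * exp (- p * (k / 2)) \<le> \<delta>" using cross[of "blk a" "blk b"] blk by blast
      have "card Z \<le> card (V \<times> V)" using fin by (intro card_mono) (auto simp: Z_def)
      then have "real (card Z) \<le> real ((card V)\<^sup>2)"
        by (simp only: of_nat_le_iff card_cartesian_product power2_eq_square)
      then have "card Z * exp (- p * (real k / 2)) \<le> (card V)\<^sup>2 * exp (- p * (k / 2))"
        by (intro mult_right_mono) auto
      then show ?thesis using \<delta>' by linarith
    qed (use \<delta> in simp)
    finally show ?thesis .
  qed
  have "measure_pmf.prob ?M {\<omega> \<in> ?N. good \<omega>} =
      measure_pmf.prob (pair_pmf (bern I p) (bern X p)) (h -` {\<omega> \<in> ?N. good \<omega>})"
    unfolding IX(1) Pi_pmf_union[OF finIX IX(2)] h_def by (rule measure_map_pmf)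
  also have "\<dots> \<le> \<delta>" by (rule prob_pair_pmf_le[OF inner \<delta>])
  finally have P2: "measure_pmf.prob ?M {\<omega> \<in> ?N. good \<omega>} \<le> \<delta>" .
  have P1: "measure_pmf.prob ?M (\<Union>B\<in>\<B>. {\<omega>. \<not> good_block B {e \<in> [B]\<^bsup>2\<^esup>. \<omega> e}}) \<le> ?S"
    by (rule prob_UN_le_sum[OF finB], rule prob_bad_block[OF finA BA _ _ p]) (use BV size in auto)
  have "?N \<subseteq> (\<Union>B\<in>\<B>. {\<omega>. \<not> good_block B {e \<in> [B]\<^bsup>2\<^esup>. \<omega> e}}) \<union> {\<omega> \<in> ?N. good \<omega>}"
    by (auto simp: good_def)
  then have "measure_pmf.prob ?M ?N \<le>
     measure_pmf.prob ?M ((\<Union>B\<in>\<B>. {\<omega>. \<not> good_block B {e \<in> [B]\<^bsup>2\<^esup>. \<omega> e}}) \<union> {\<omega> \<in> ?N. good \<omega>})"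
    by (intro measure_pmf.finite_measure_mono) auto
  also have "\<dots> \<le> measure_pmf.prob ?M (\<Union>B\<in>\<B>. {\<omega>. \<not> good_block B {e \<in> [B]\<^bsup>2\<^esup>. \<omega> e}}) +
      measure_pmf.prob ?M {\<omega> \<in> ?N. good \<omega>}"
    by (rule measure_Un_le) auto
  also have "\<dots> \<le> ?S + \<delta>" using P1 P2 by (rule add_mono)
  finally show ?thesis .
qed

text \<open>Split off sets of size \<open>k\<close> while at least \<open>2 * k\<close> vertices
  remain; the remainder is the last block.\<close>

lemma partition_into_blocks:
  assumes "finite V" "1 \<le> k" "k \<le> card V"
  shows "\<exists>\<B>. pairwise disjnt \<B> \<and> \<Union>\<B> = V \<and> finite \<B> \<and> card \<B> \<le> card V \<and>
    (\<forall>B\<in>\<B>. k \<le> card B \<and> card B \<le> 2 * k)"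
  using assms(1,3)
proof (induction "card V" arbitrary: V rule: less_induct)
  case less
  show ?case
  proof (cases "card V < 2 * k")
    case True
    then show ?thesis using less.prems assms(2)
      by (intro exI[of _ "{V}"]) auto
  next
    case False
    obtain B where B: "B \<subseteq> V" "card B = k" using obtain_subset_with_card_n[OF less.prems(2)] by metis
    have finB: "finite B" using B less.prems finite_subset by blast
    have card: "card (V - B) = card V - k" using B finB by (simp add: card_Diff_subset)
    have "card (V - B) < card V" "k \<le> card (V - B)" using card False assms(2) by auto
    then obtain \<B> where \<B>: "pairwise disjnt \<B>" "\<Union>\<B> = V - B" "finite \<B>" "card \<B> \<le> card (V - B)"
      "\<forall>B\<in>\<B>. k \<le> card B \<and> card B \<le> 2 * k"
      using less.hyps[of "V - B"] less.prems(1) by (metis finite_Diff)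
    have "pairwise disjnt (insert B \<B>)"
      unfolding pairwise_insert
    proof (intro conjI allI impI)
      fix C assume "C \<in> \<B> \<and> C \<noteq> B"
      then have "C \<subseteq> V - B" using \<B>(2) by blast
      then show "disjnt B C" "disjnt C B" by (auto simp: disjnt_def)
    qed (rule \<B>(1))
    moreover have "\<Union>(insert B \<B>) = V" using \<B>(2) B(1) by auto
    moreover have "card (insert B \<B>) \<le> card V"
      using \<B>(3,4) card assms(2) less.prems(2) card_insert_le_m1[of "card V" \<B> B] by simp
    ultimately show ?thesis using \<B>(3,5) B(2) by (intro exI[of _ "insert B \<B>"]) auto
  qed
qed

text \<open>A strategy certifies connectedness as well as the time bound, so one failure event
  controls both.\<close>

lemma prob_acquaintance_time_le:
  fixes p t \<epsilon> :: real and n L :: nat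
  assumes n: "n > 0" and L: "real L \<le> t"
    and fail: "measure_pmf.prob (bern ([{1..n}]\<^bsup>2\<^esup>) p)
      {\<omega>. \<not> (\<exists>Ms. length Ms = L \<and> acquaintance_strategy {1..n} {e \<in> [{1..n}]\<^bsup>2\<^esup>. \<omega> e} Ms)} \<le> \<epsilon>"
  shows "measure_pmf.prob (gnp n p)
      {E. connected_graph {1..n} E \<and> ereal_of_enat (acquaintance_time {1..n} E) \<le> ereal t} \<ge> 1 - \<epsilon>"
    (is "measure_pmf.prob _ ?G \<ge> _")
proof -
  let ?V = "{1..n}"
  let ?e = "\<lambda>\<omega>. {e \<in> [?V]\<^bsup>2\<^esup>. \<omega> e}"
  have "?e \<omega> \<in> ?G" if "length Ms = L" "acquaintance_strategy ?V (?e \<omega>) Ms" for Ms \<omega>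
  proof -
    have "connected_graph ?V (?e \<omega>)"
      using that(2) n by (intro strategy_imp_connected[of _ _ Ms]) auto
    moreover have "acquaintance_time ?V (?e \<omega>) \<le> enat L"
      unfolding acquaintance_time_def using that by (intro INF_lower2[of Ms]) auto
    then have "ereal_of_enat (acquaintance_time ?V (?e \<omega>)) \<le> ereal_of_enat (enat L)"
      by (simp only: ereal_of_enat_le_iff)
    then have "ereal_of_enat (acquaintance_time ?V (?e \<omega>)) \<le> ereal t"
      using L by (auto intro: order_trans)
    ultimately show ?thesis by simp
  qed
  then have sub: "- (?e -` ?G) \<subseteq> {\<omega>. \<not> (\<exists>Ms. length Ms = L \<and> acquaintance_strategy ?V (?e \<omega>) Ms)}"
    by auto
  have "measure_pmf.prob (gnp n p) ?G = measure_pmf.prob (bern ([?V]\<^bsup>2\<^esup>) p) (?e -` ?G)"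
    unfolding gnp_def by (rule measure_map_pmf)
  also have "\<dots> = 1 - measure_pmf.prob (bern ([?V]\<^bsup>2\<^esup>) p) (- (?e -` ?G))"
    using measure_pmf.prob_compl[of "?e -` ?G" "bern ([?V]\<^bsup>2\<^esup>) p"] by (simp add: Compl_eq_Diff_UNIV)
  also have "\<dots> \<ge> 1 - \<epsilon>"
    using measure_pmf.finite_measure_mono[OF sub, of "bern ([?V]\<^bsup>2\<^esup>) p"] fail by simp
  finally show ?thesis .
qed

text \<open>If \<open>p * n \<le> 12 * ln n\<close>, then \<open>n\<close> is already of order
  \<open>ln n / p\<close> and a single block suffices. Otherwise blocks of order
  \<open>ln n / p\<close> are large enough for failure probabilities that are powers of
  \<open>1 / n\<close>.\<close>

lemma gnp_acquaintance_time:
  fixes p :: real and n :: nat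
  assumes n25: "n \<ge> 25" and n: "ln (real n) \<ge> 3" and p: "p \<in> {0..1}" and w: "p * n - ln n \<ge> 0"
  defines "c \<equiv> 2 * exp 2 + exp (35 :: real)"
  shows "measure_pmf.prob (gnp n p)
      {E. connected_graph {1..n} E \<and>
        ereal_of_enat (acquaintance_time {1..n} E) \<le> ereal (104000 * (ln n / p))}
    \<ge> 1 - (c * exp (- (p * n - ln n) / 2) + (c + 1) / n)"
proof -
  let ?V = "{1..n}"
  have n0: "n > 0" using n by (cases n) auto
  have p0: "p > 0"
  proof (rule ccontr)
    assume "\<not> p > 0"
    then have "p = 0" using p by simp
    then show False using w n by simp
  qed
  have c0: "c > 0" unfolding c_def by (intro add_pos_pos) auto
  have lnp: "ln n / p \<ge> ln n" using p p0 n by (simp add: field_simps mult_left_le_one_le)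
  show ?thesis
  proof (cases "p * n \<le> 12 * ln n")
    case True
    \<comment> \<open>A single block has no crossing pairs, so \<open>k = 0\<close> and crossing
      error \<open>0\<close> are admissible.\<close>
    have "measure_pmf.prob (bern ([?V]\<^bsup>2\<^esup>) p)
      {\<omega>. \<not> (\<exists>Ms. length Ms = 4000 * n \<and> acquaintance_strategy ?V {e \<in> [?V]\<^bsup>2\<^esup>. \<omega> e} Ms)}
      \<le> (\<Sum>B\<in>{?V}. (2 * exp 2 + exp 35) * exp (- (p * card B - ln (card B)) / 2)) + 0"
      by (rule prob_no_strategy[where k = 0]) (use p n25 in auto)
    then have *: "measure_pmf.prob (bern ([?V]\<^bsup>2\<^esup>) p)
      {\<omega>. \<not> (\<exists>Ms. length Ms = 4000 * n \<and> acquaintance_strategy ?V {e \<in> [?V]\<^bsup>2\<^esup>. \<omega> e} Ms)}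
      \<le> c * exp (- (p * n - ln n) / 2)" by (simp add: c_def)
    have "real n \<le> 12 * (ln n / p)" using True p0 by (simp add: field_simps)
    then have "real (4000 * n) \<le> 104000 * (ln n / p)" using n lnp by simp
    from prob_acquaintance_time_le[OF n0 this *] show ?thesis using c0
      by (smt (verit) divide_nonneg_nonneg of_nat_0_le_iff)
  next
    case False
    \<comment> \<open>The factor \<open>12\<close> gives
      \<open>exp (- p * k / 2) \<le> n ^ (-6)\<close>. This beats the \<open>n ^ 2\<close> pairs of
      agents, and it leaves at most \<open>c / n ^ 2\<close> for each of at most \<open>n\<close>
      blocks.\<close>
    define k where "k = nat \<lceil>12 * (ln n / p)\<rceil>"
    have k1: "real k \<ge> 12 * (ln n / p)" by (simp add: k_def of_nat_ceiling)
    have k2: "real k \<le> 12 * (ln n / p) + 1" using lnp n unfolding k_def by linarith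
    have k25: "k \<ge> 25" using k1 lnp n by linarith
    have "12 * (ln n / p) \<le> real n" using False p0 by (simp add: field_simps)
    then have kn: "k \<le> n" unfolding k_def by (simp add: nat_le_iff ceiling_le_iff)
    have pk: "p * k \<ge> 12 * ln n"
    proof -
      have "p * (12 * (ln n / p)) \<le> p * k" using k1 p0 by (intro mult_left_mono) auto
      then show ?thesis using p0 by simp
    qed
    obtain \<B> where \<B>: "pairwise disjnt \<B>" "\<Union>\<B> = ?V" "finite \<B>" "card \<B> \<le> n"
      "\<forall>B\<in>\<B>. k \<le> card B \<and> card B \<le> 2 * k"
      using partition_into_blocks[of ?V k] k25 kn by auto
    have inv: "exp (- (real m * ln n)) = 1 / real n ^ m" for m
      using n0 by (simp add: exp_minus exp_of_nat_mult divide_inverse)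
    have \<delta>: "(card ?V)\<^sup>2 * exp (- p * (real k / 2)) \<le> 1 / n"
    proof -
      have "exp (- p * (real k / 2)) \<le> exp (- (real 3 * ln n))" using pk n by simp
      also have "\<dots> = 1 / real n ^ 3" by (rule inv)
      finally have "(card ?V)\<^sup>2 * exp (- p * (real k / 2)) \<le> (card ?V)\<^sup>2 * (1 / real n ^ 3)"
        by (intro mult_left_mono) auto
      also have "\<dots> = 1 / n" using n0 by (simp add: field_simps power2_eq_square power3_eq_cube)
      finally show ?thesis .
    qed
    have "measure_pmf.prob (bern ([?V]\<^bsup>2\<^esup>) p)
      {\<omega>. \<not> (\<exists>Ms. length Ms = 8000 * k \<and> acquaintance_strategy ?V {e \<in> [?V]\<^bsup>2\<^esup>. \<omega> e} Ms)}
      \<le> (\<Sum>B\<in>\<B>. (2 * exp 2 + exp 35) * exp (- (p * card B - ln (card B)) / 2)) + 1 / n"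
      by (rule prob_no_strategy[OF _ \<B>(1,2) p _ _ \<delta>]) (use \<B>(5) k25 in force)+
    also have "(\<Sum>B\<in>\<B>. (2 * exp 2 + exp 35) * exp (- (p * card B - ln (card B)) / 2))
      \<le> (\<Sum>B\<in>\<B>. c * (1 / real n ^ 2))"
    proof (rule sum_mono)
      fix B assume B: "B \<in> \<B>"
      have "card B \<le> n" "card B \<ge> k"
        using B \<B>(2,5) card_mono[of ?V B] by auto
      then have "ln (card B) \<le> ln n" "p * k \<le> p * card B" using k25 p0 by auto
      then have "- (p * card B - ln (card B)) / 2 \<le> - (real 2 * ln n)" using pk n by simp
      then have "exp (- (p * card B - ln (card B)) / 2) \<le> exp (- (real 2 * ln n))" by simp
      then have "exp (- (p * card B - ln (card B)) / 2) \<le> 1 / real n ^ 2" unfolding inv .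
      then show "(2 * exp 2 + exp 35) * exp (- (p * card B - ln (card B)) / 2) \<le> c * (1 / real n ^ 2)"
        unfolding c_def[symmetric] using c0 by (intro mult_left_mono) auto
    qed
    also have "\<dots> = card \<B> * (c * (1 / real n ^ 2))" by simp
    also have "\<dots> \<le> n * (c * (1 / real n ^ 2))" using \<B>(4) c0 by (intro mult_right_mono) auto
    also have "\<dots> = c / n" using n0 by (simp add: power2_eq_square)
    finally have *: "measure_pmf.prob (bern ([?V]\<^bsup>2\<^esup>) p)
      {\<omega>. \<not> (\<exists>Ms. length Ms = 8000 * k \<and> acquaintance_strategy ?V {e \<in> [?V]\<^bsup>2\<^esup>. \<omega> e} Ms)}
      \<le> c / n + 1 / n" by simp
    \<comment> \<open>Blocks have at most \<open>2 * k\<close> vertices, hence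
      \<open>8000 * k\<close> rounds. The rounding in \<open>k\<close> costs at most one further
      \<open>ln n / p\<close>, and \<open>104000 = 8000 * 13\<close>.\<close>
    have "real (8000 * k) \<le> 104000 * (ln n / p)" using k2 lnp n by simp
    from prob_acquaintance_time_le[OF n0 this *] show ?thesis using c0
      by (smt (verit) add_divide_distrib exp_ge_zero mult_nonneg_nonneg)
  qed
qed

theorem theorem1p1:
  fixes p :: "nat \<Rightarrow> real"
  assumes "\<And>n. p n \<in> {0..1}"
    and "filterlim (\<lambda>n. p n * real n - ln (real n)) at_top sequentially"
  shows "\<exists>C>0. (\<lambda>n. measure_pmf.prob (gnp n (p n))
            {E. connected_graph {1..n} E \<and>
                ereal_of_enat (acquaintance_time {1..n} E) \<le> ereal (C * (ln (real n) / p n))})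
          \<longlonglongrightarrow> 1"
proof (intro exI[of _ 104000] conjI)
  define w where "w = (\<lambda>n. p n * real n - ln (real n))"
  define c where "c = 2 * exp 2 + exp (35 :: real)"
  have w: "filterlim w at_top sequentially" using assms(2) by (simp add: w_def)
  have "filterlim (\<lambda>n. (1 / 2) * w n) at_top sequentially"
    by (rule filterlim_tendsto_pos_mult_at_top[OF tendsto_const _ w]) simp
  then have "filterlim (\<lambda>n. - ((1 / 2) * w n)) at_bot sequentially"
    by (simp add: filterlim_uminus_at_top)
  then have "(\<lambda>n. exp (- ((1 / 2) * w n))) \<longlonglongrightarrow> 0"
    by (rule filterlim_compose[OF exp_at_bot])
  then have e: "(\<lambda>n. exp (- w n / 2)) \<longlonglongrightarrow> 0" by simp
  have i: "(\<lambda>n. (c + 1) / real n) \<longlonglongrightarrow> 0" by (rule lim_const_over_n)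
  have low: "(\<lambda>n. 1 - (c * exp (- w n / 2) + (c + 1) / real n)) \<longlonglongrightarrow> 1"
    using tendsto_diff[OF tendsto_const tendsto_add[OF tendsto_mult[OF tendsto_const e] i], of 1 c] by simp
  have "filterlim (\<lambda>n. ln (real n)) at_top sequentially"
    by (rule filterlim_compose[OF ln_at_top filterlim_real_sequentially])
  then have ev: "eventually (\<lambda>n. n \<ge> 25 \<and> ln (real n) \<ge> 3 \<and> w n \<ge> 0) sequentially"
    using w by (intro eventually_conj eventually_ge_at_top) (simp_all add: filterlim_at_top)
  show "(\<lambda>n. measure_pmf.prob (gnp n (p n))
            {E. connected_graph {1..n} E \<and>
                ereal_of_enat (acquaintance_time {1..n} E) \<le> ereal (104000 * (ln (real n) / p n))})
          \<longlonglongrightarrow> 1"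
  \<comment> \<open>The probability is squeezed between the explicit lower bound, valid for large
    \<open>n\<close>, and \<open>1\<close>.\<close>
  proof (rule tendsto_sandwich[OF _ _ low tendsto_const])
    show "eventually (\<lambda>n. 1 - (c * exp (- w n / 2) + (c + 1) / real n) \<le>
       measure_pmf.prob (gnp n (p n))
            {E. connected_graph {1..n} E \<and>
                ereal_of_enat (acquaintance_time {1..n} E) \<le> ereal (104000 * (ln (real n) / p n))}) sequentially"
      using ev
    proof eventually_elim
      case (elim n)
      then show ?case using gnp_acquaintance_time[of n "p n"] assms(1)[of n] by (simp add: w_def c_def)
    qed
  qed (simp add: measure_pmf.prob_le_1)
qed simp

end
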